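(* Let $G$ be a connected graph of order $n$ with minimum degree $\delta_G=\delta$. It is known that $$\tau_G\geq \frac{\mu_1^G\mu_{n-1}^G}{n(\mu_1^G-\delta)}\qquad\text{(A)}\qquad\text{and}\qquad \tau_G\geq \frac{\mu_{n-1}^G}{\mu_1^G-\mu_{n-1}^G}\qquad\text{(B)}.$$ Then equality holds in (A) if and only if $G\cong H\vee (n-\delta)K_1$, where $1\leq \delta\leq n-2$ and $H$ is a graph of order $\delta$ with $\mu_{\delta-1}^H\geq 2\delta-n$; and likewise equality holds in (B) if and only if $G\cong H\vee (n-\delta)K_1$, where $1\leq \delta\leq n-2$ and $H$ is a graph of order $\delta$ with $\mu_{\delta-1}^H\geq 2\delta-n$.
   Context: All graphs are finite, simple and undirected. For a non-complete connected graph $G$, the toughness is $\tau_G=\min\{|S|/\omega_{G-S} : S\subseteq V_G,\ \omega_{G-S}\geq 2\}$, where $\omega_{G-S}$ is the number of connected components of the graph obtained from $G$ by deleting the vertices of $S$; by convention $\tau_{K_n}=\infty$. For a graph $F$ on $k$ vertices, $\mu_1^F\geq\mu_2^F\geq\cdots\geq\mu_k^F$ denote the eigenvalues of the Laplacian matrix $L_F=D_F-A_F$ ($D_F$ the diagonal degree matrix, $A_F$ the adjacency matrix). The join $G_1\vee G_2$ is obtained from the disjoint union of $G_1$ and $G_2$ by joining every vertex of $G_1$ to every vertex of $G_2$; $(n-\delta)K_1$ denotes the edgeless graph on $n-\delta$ vertices. *)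

theory Defs
  imports
    "Graph_Theory.Graph_Theory"
    "Jordan_Normal_Form.Char_Poly"
    "HOL-Library.Extended_Real"
begin

text \<open>
  A finite simple undirected graph is a \<^const>\<open>pair_graph\<close>: a finite, loop-free, symmetric
  digraph without parallel arcs, so each edge is represented by a pair of opposite arcs. In
  particular the degree of a vertex is its \<^const>\<open>out_degree\<close>.
\<close>

definition min_degree :: "('a, 'b) pre_digraph \<Rightarrow> nat" where
  "min_degree G = Min (out_degree G ` verts G)"

definition num_components :: "('a, 'b) pre_digraph \<Rightarrow> nat" where
  "num_components G = card {C. pre_digraph.max_subgraph G Digraph_Component.connected C}"

definition toughness :: "('a, 'b) pre_digraph \<Rightarrow> ereal" where
  "toughness G =
    (if complete_digraph (card (verts G)) G then \<infinity>
     else ereal (Min {real (card S) / real (num_components (G \<restriction> (verts G - S))) | S.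
                       S \<subseteq> verts G \<and> num_components (G \<restriction> (verts G - S)) \<ge> 2}))"

text \<open>Matrices of a graph with respect to an enumeration \<open>vs\<close> of its vertices.\<close>

definition adjacency_matrix :: "'a list \<Rightarrow> ('a, 'b) pre_digraph \<Rightarrow> real mat" where
  "adjacency_matrix vs G =
    mat (length vs) (length vs) (\<lambda>(i, j). if vs ! i \<rightarrow>\<^bsub>G\<^esub> vs ! j then 1 else 0)"

definition degree_matrix :: "'a list \<Rightarrow> ('a, 'b) pre_digraph \<Rightarrow> real mat" where
  "degree_matrix vs G =
    mat (length vs) (length vs) (\<lambda>(i, j). if i = j then real (out_degree G (vs ! i)) else 0)"

definition laplacian_matrix :: "'a list \<Rightarrow> ('a, 'b) pre_digraph \<Rightarrow> real mat" where
  "laplacian_matrix vs G = degree_matrix vs G - adjacency_matrix vs G"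

definition vertex_list :: "('a, 'b) pre_digraph \<Rightarrow> 'a list" where
  "vertex_list G = (SOME vs. distinct vs \<and> set vs = verts G)"

text \<open>
  The Laplacian eigenvalues, with multiplicity, in non-increasing order. The choice of the
  enumeration is immaterial, since another one yields a similar matrix. As the Laplacian matrix
  is real symmetric, all its eigenvalues are real and the list has length \<open>card (verts G)\<close>.
\<close>

definition laplacian_spectrum :: "('a, 'b) pre_digraph \<Rightarrow> real list" where
  "laplacian_spectrum G =
    rev (sorted_list_of_multiset (proots (char_poly (laplacian_matrix (vertex_list G) G))))"

text \<open>Indices start at 1, so that \<open>laplacian_eigenvalue G 1\<close> is the largest eigenvalue;
  values at indices outside \<open>{1..card (verts G)}\<close> are meaningless.\<close>

definition laplacian_eigenvalue :: "('a, 'b) pre_digraph \<Rightarrow> nat \<Rightarrow> real" where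
  "laplacian_eigenvalue G i = laplacian_spectrum G ! (i - 1)"

definition graph_join ::
  "'a pair_pre_digraph \<Rightarrow> 'b pair_pre_digraph \<Rightarrow> ('a + 'b) pair_pre_digraph" where
  "graph_join G H =
    \<lparr> pverts = Inl ` pverts G \<union> Inr ` pverts H,
      parcs = map_prod Inl Inl ` parcs G \<union> map_prod Inr Inr ` parcs H
        \<union> (Inl ` pverts G) \<times> (Inr ` pverts H) \<union> (Inr ` pverts H) \<times> (Inl ` pverts G) \<rparr>"

definition edgeless_graph :: "nat \<Rightarrow> nat pair_pre_digraph" where
  "edgeless_graph m = \<lparr> pverts = {..<m}, parcs = {} \<rparr>"

end

theory Submission
  imports Defs "Jordan_Normal_Form.Schur_Decomposition"
begin

text \<open>
  Write \<open>\<lambda>\<close> for the second smallest and \<open>\<mu>\<close> for the largest Laplacian eigenvalue; both are extremal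
  values of the Dirichlet form on vectors orthogonal to the all-ones vector. Let \<open>S\<close> with \<open>|S| = s\<close>
  leave \<open>c \<ge> 2\<close> components.

  (A) Separating \<open>V - S\<close> into two unions of components \<open>A\<close>, \<open>B\<close> and testing with \<open>|B|\<close> on \<open>A\<close>, \<open>-|A|\<close> on \<open>B\<close>
  and \<open>0\<close> on \<open>S\<close> gives \<open>\<lambda> \<le> s\<close>, with equality only if \<open>S\<close> is completely joined to the rest, in which
  case \<open>\<mu> \<ge> n\<close>. One vertex from each component forms an independent set, so the ratio bound
  \<open>n\<delta> \<le> \<mu>(n - c)\<close> holds. Multiplying both gives (A); in the case of equality \<open>n - c \<le> \<delta>\<close>, so each
  representative is adjacent to all non-representatives, which forces every component to be a
  single vertex.

  (B) If some component is not a single vertex, the components can be split with \<open>2|A| > c\<close> and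
  \<open>2|B| \<ge> c\<close>. The indicator of \<open>A \<union> B\<close> and the signed indicator of \<open>A\<close> minus \<open>B\<close> have the same energy, so
  \<open>\<lambda>((|A|+|B|)s + 4|A||B|) \<le> \<mu>s(|A|+|B|)\<close>, which excludes equality. Otherwise \<open>V - S\<close> is independent,
  equality reads \<open>s\<mu> = n\<lambda>\<close>, and the ratio bound yields \<open>v \<in> V - S\<close> with \<open>deg v \<le> \<lambda>\<close>; its neighbourhood
  is a separator of order \<open>\<lambda>\<close>, hence completely joined to the rest, hence equal to \<open>S\<close>.

  Conversely, for such a join \<open>\<mu> = n\<close> and \<open>\<lambda> \<le> \<delta>\<close>, the condition on \<open>H\<close> says exactly that \<open>\<lambda> = \<delta>\<close>, and the
  two inequalities behind (A) show that \<open>S = V(H)\<close> attains the toughness.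
\<close>

section \<open>Orthogonal diagonalisation of real symmetric matrices\<close>

text \<open>Gram-Schmidt keeps the first vector of a basis, so a basis starting with
  \<open>v\<close> becomes orthonormal with only a scaling of \<open>v\<close>. This supplies the
  change of basis that splits off one eigenvector.\<close>

lemma orthonormal_completion:
  fixes v :: "real vec"
  assumes v: "v \<in> carrier_vec n" and v0: "v \<noteq> 0\<^sub>v n"
  obtains W k where "W \<in> carrier_mat n n" "W\<^sup>T * W = 1\<^sub>m n" "col W 0 = k \<cdot>\<^sub>v v"
proof -
  have n: "n > 0" using assms by (metis carrier_vecD eq_vecI gr_zeroI index_zero_vec(2) less_nat_zero_code)
  interpret cof_vec_space n "TYPE(real)" .
  define b where "b = basis_completion v"
  define ws where "ws = gram_schmidt n b"
  define N where "N = (\<lambda>w::real vec. (1 / sqrt (w \<bullet> w)) \<cdot>\<^sub>v w)"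
  define W where "W = mat_of_cols n (map N ws)"
  from basis_completion[OF v v0, folded b_def]
  have dist_b: "distinct b" and indep: "\<not> lin_dep (set b)" and b: "set b \<subseteq> carrier_vec n"
    and hdb: "hd b = v" and len_b: "length b = n" by auto
  from hdb len_b n obtain vs where bv: "b = v # vs" by (cases b, auto)
  from gram_schmidt_result[OF b dist_b indep refl, folded ws_def]
  have ws: "set ws \<subseteq> carrier_vec n" "corthogonal ws" "length ws = n"
    by (auto simp: len_b)
  from gram_schmidt_hd[OF v, of vs, folded bv] have "hd ws = v" unfolding ws_def .
  then have ws0: "ws ! 0 = v" using ws(3) n by (metis hd_conv_nth length_greater_0_conv)
  have wsc: "ws ! i \<in> carrier_vec n" if "i < n" for i using ws that by auto
  \<comment> \<open>Over the reals conjugation is trivial, so \<open>corthogonal\<close> means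
    ordinary orthogonality.\<close>
  have conj: "conjugate w = w" for w :: "real vec"
    by (rule eq_vecI) auto
  have orth: "ws ! i \<bullet> ws ! j = 0 \<longleftrightarrow> i \<noteq> j" if "i < n" "j < n" for i j
    using corthogonalD[OF ws(2), of i j] that ws(3) by (simp add: conj)
  have pos: "ws ! i \<bullet> ws ! i > 0" if "i < n" for i
  proof -
    have "ws ! i \<bullet> ws ! i \<ge> 0" by (auto simp: scalar_prod_def intro!: sum_nonneg)
    with orth[OF that that] show ?thesis by simp
  qed
  have W: "W \<in> carrier_mat n n" using ws(3) by (auto simp: W_def)
  have colW: "col W i = N (ws ! i)" if "i < n" for i
    using that ws(3) wsc[OF that] by (auto simp: W_def N_def col_mat_of_cols)
  have "W\<^sup>T * W = 1\<^sub>m n"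
  proof (rule eq_matI)
    fix i j assume "i < dim_row (1\<^sub>m n :: real mat)" "j < dim_col (1\<^sub>m n :: real mat)"
    then have ij: "i < n" "j < n" by auto
    have "(W\<^sup>T * W) $$ (i, j) = N (ws ! i) \<bullet> N (ws ! j)"
      using W ij colW by auto
    also have "\<dots> = (ws ! i \<bullet> ws ! j) / (sqrt (ws ! i \<bullet> ws ! i) * sqrt (ws ! j \<bullet> ws ! j))"
      using wsc[OF ij(1)] wsc[OF ij(2)] by (simp add: N_def)
    also have "\<dots> = (1\<^sub>m n :: real mat) $$ (i, j)"
      using orth[OF ij] pos[OF ij(1)] ij by auto
    finally show "(W\<^sup>T * W) $$ (i, j) = (1\<^sub>m n :: real mat) $$ (i, j)" .
  qed (use W in auto)
  moreover have "col W 0 = (1 / sqrt (v \<bullet> v)) \<cdot>\<^sub>v v" using colW[OF n] ws0 by (simp add: N_def)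
  ultimately show ?thesis using that W by blast
qed

text \<open>The polynomial factors over the complex numbers, and every root is real by the usual
  argument: for an eigenvector \<open>v\<close>, evaluating the sesquilinear form at
  \<open>v\<close> in two ways gives \<open>a = cnj a\<close>. Injectivity of the embedding of real
  polynomials brings the factorisation back.\<close>

lemma real_symmetric_char_poly_splits:
  fixes A :: "real mat"
  assumes A: "A \<in> carrier_mat n n" and sym: "A\<^sup>T = A"
  shows "\<exists>es. char_poly A = (\<Prod>e \<leftarrow> es. [:- e, 1:])"
proof -
  let ?c = complex_of_real
  interpret p: map_poly_inj_comm_ring_hom ?c ..
  let ?B = "map_mat ?c A"
  have B: "?B \<in> carrier_mat n n" using A by auto
  from char_poly_factorized[OF B] obtain as where
    as: "char_poly ?B = (\<Prod>a \<leftarrow> as. [:- a, 1:])" by auto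
  have real: "\<exists>r. a = ?c r" if "a \<in> set as" for a
  proof -
    have "poly (char_poly ?B) a = 0" unfolding as using that by (rule linear_poly_root)
    then have "eigenvalue ?B a" using eigenvalue_root_char_poly[OF B] by simp
    then obtain v where "eigenvector ?B v a" unfolding eigenvalue_def by auto
    then have v: "v \<in> carrier_vec n" and v0: "v \<noteq> 0\<^sub>v n" and ev: "?B *\<^sub>v v = a \<cdot>\<^sub>v v"
      using A by (auto simp: eigenvector_def)
    define w where "w = conjugate v"
    have w: "w \<in> carrier_vec n" using v by (simp add: w_def)
    have "cnj ((?B *\<^sub>v v) $ i) = (?B *\<^sub>v w) $ i" if "i < n" for i
      using that A v w by (auto simp: w_def scalar_prod_def intro!: sum.cong)
    then have ew: "?B *\<^sub>v w = cnj a \<cdot>\<^sub>v w"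
      using A v w by (intro eq_vecI) (auto simp: ev w_def)
    have "a * (w \<bullet> v) = w \<bullet> (?B *\<^sub>v v)" using v w ev by simp
    also have "\<dots> = (?B\<^sup>T *\<^sub>v w) \<bullet> v" 
      using transpose_vec_mult_scalar[OF B v w] by simp
    also have "?B\<^sup>T = ?B" using sym by (metis map_mat_transpose)
    also have "(?B *\<^sub>v w) \<bullet> v = cnj a * (w \<bullet> v)" using v w ew by simp
    finally have "(a - cnj a) * (w \<bullet> v) = 0" by (simp add: algebra_simps)
    moreover have "w \<bullet> v \<noteq> 0"
      using conjugate_square_eq_0_vec[OF v] v0 v w comm_scalar_prod[OF v w] by (auto simp: w_def)
    ultimately have "a = cnj a" by simp
    then have "a = ?c (Re a)" by (simp add: complex_eq_iff)
    then show ?thesis by blast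
  qed
  then have "\<forall>a \<in> set as. ?c (Re a) = a" by fastforce
  then have id: "map (\<lambda>a. ?c (Re a)) as = as" by (simp add: map_idI)
  have "map_poly ?c (char_poly A) = (\<Prod>a \<leftarrow> map (\<lambda>a. ?c (Re a)) as. [:- a, 1:])"
    unfolding id as[symmetric] by (rule of_real_hom.char_poly_hom[OF A, symmetric])
  also have "\<dots> = map_poly ?c (\<Prod>e \<leftarrow> map Re as. [:- e, 1:])"
    by (simp add: p.hom_prod_list o_def)
  finally show ?thesis using p.injectivity by blast
qed

text \<open>Deflation, by induction on the list of roots. The order of \<open>es\<close> is
  prescribed rather than chosen, so that the diagonal can later be taken sorted.\<close>

lemma real_symmetric_spectral:
  fixes A :: "real mat"
  assumes "A \<in> carrier_mat n n" "A\<^sup>T = A" "char_poly A = (\<Prod>e \<leftarrow> es. [:- e, 1:])"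
  shows "length es = n \<and> (\<exists>P \<in> carrier_mat n n. P\<^sup>T * P = 1\<^sub>m n \<and>
    P\<^sup>T * A * P = mat n n (\<lambda>(i, j). if i = j then es ! i else 0))"
  using assms
proof (induction es arbitrary: n A)
  case Nil
  then have "n = 0" using degree_monic_char_poly[of A n] by auto
  then show ?case using Nil by (auto intro!: bexI[of _ "1\<^sub>m 0"])
next
  case (Cons e es n A)
  note A = Cons.prems(1) and sym = Cons.prems(2)
  have cp: "char_poly A = [:-e, 1:] * (\<Prod>e \<leftarrow> es. [:- e, 1:])" using Cons.prems(3) by simp
  have "eigenvalue A e" unfolding eigenvalue_root_char_poly[OF A] cp by simp
  then obtain v where v: "v \<in> carrier_vec n" and v0: "v \<noteq> 0\<^sub>v n" and ev: "A *\<^sub>v v = e \<cdot>\<^sub>v v"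
    using A by (auto simp: eigenvalue_def eigenvector_def)
  have "n > 0" using v v0 by (metis carrier_vecD eq_vecI gr_zeroI index_zero_vec(2) less_nat_zero_code)
  then obtain m where n: "n = Suc m" by (cases n) auto
  obtain W k where W: "W \<in> carrier_mat n n" and WW: "W\<^sup>T * W = 1\<^sub>m n" and W0: "col W 0 = k \<cdot>\<^sub>v v"
    using orthonormal_completion[OF v v0] .
  have WT: "W\<^sup>T \<in> carrier_mat n n" using W by simp
  have WW': "W * W\<^sup>T = 1\<^sub>m n" using mat_mult_left_right_inverse[OF WT W WW] .
  define A' where "A' = W\<^sup>T * A * W"
  have A': "A' \<in> carrier_mat n n" using W A by (simp add: A'_def)
  have A'T: "A'\<^sup>T = A'"
  proof -
    have "A'\<^sup>T = W\<^sup>T * (W\<^sup>T * A)\<^sup>T"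
      unfolding A'_def using W WT A by (intro transpose_mult) auto
    also have "(W\<^sup>T * A)\<^sup>T = A * W" using transpose_mult[OF WT A] sym by simp
    finally show ?thesis using assoc_mult_mat[OF WT A W] by (simp add: A'_def)
  qed
  \<comment> \<open>Column 0 of \<open>W\<close> is an eigenvector orthogonal to the other columns;
    by symmetry of \<open>A'\<close> the first row vanishes off the diagonal as well.\<close>
  have A'0: "A' $$ (i, 0) = (if i = 0 then e else 0)" if i: "i < n" for i
  proof -
    have "A' = W\<^sup>T * (A * W)" unfolding A'_def using W A by (simp add: assoc_mult_mat[of _ n n _ n _ n])
    then have "A' $$ (i, 0) = col W i \<bullet> col (A * W) 0" using W A i n by simp
    also have "col (A * W) 0 = A *\<^sub>v col W 0" using col_mult2[OF A W] n by blast
    also have "\<dots> = e \<cdot>\<^sub>v col W 0"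
      unfolding W0 using mult_mat_vec[OF A v, of k] ev by (simp add: smult_smult_assoc mult.commute)
    also have "col W i \<bullet> (e \<cdot>\<^sub>v col W 0) = e * (W\<^sup>T * W) $$ (i, 0)"
      using W i n by simp
    finally show ?thesis using i n by (simp add: WW)
  qed
  define A3 where "A3 = mat m m (\<lambda>(i, j). A' $$ (Suc i, Suc j))"
  let ?E = "mat 1 1 (\<lambda>_. e)"
  have A3: "A3 \<in> carrier_mat m m" by (simp add: A3_def)
  have swap: "A' $$ (j, i) = A' $$ (i, j)" if "i < n" "j < n" for i j
    using that A' by (subst A'T[symmetric]) simp
  have A3T: "A3\<^sup>T = A3" by (rule eq_matI) (auto simp: A3_def swap n)
  have block: "A' = four_block_mat ?E (0\<^sub>m 1 m) (0\<^sub>m m 1) A3"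
  proof (rule eq_matI)
    fix i j assume "i < dim_row (four_block_mat ?E (0\<^sub>m 1 m) (0\<^sub>m m 1) A3)"
      "j < dim_col (four_block_mat ?E (0\<^sub>m 1 m) (0\<^sub>m m 1) A3)"
    then have "i < n" "j < n" using A3 n by auto
    then show "A' $$ (i, j) = four_block_mat ?E (0\<^sub>m 1 m) (0\<^sub>m m 1) A3 $$ (i, j)"
      using A'0 swap[of 0 j] swap[of i 0] A3 by (cases i; cases j) (auto simp: n A3_def)
  qed (use A' A3 n in auto)
  have "similar_mat_wit A' A (W\<^sup>T) W"
    by (rule similar_mat_witI[of _ _ n]) (use W A A' WW WW' in \<open>auto simp: A'_def\<close>)
  then have "similar_mat A' A" unfolding similar_mat_def by blast
  from char_poly_similar[OF this] cp
  have "char_poly A' = [:-e, 1:] * (\<Prod>e \<leftarrow> es. [:- e, 1:])" by simp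
  also have "char_poly A' = char_poly ?E * char_poly A3"
    unfolding block by (rule char_poly_four_block_zeros_col) (use A3 in auto)
  also have "char_poly ?E = [:-e, 1:]" by (simp add: char_poly_defs det_def sign_def)
  finally have "char_poly A3 = (\<Prod>e \<leftarrow> es. [:- e, 1:])"
    by (metis mult_cancel_left pCons_eq_0_iff zero_neq_one)
  from Cons.IH[OF A3 A3T this] obtain P where len: "length es = m" and P: "P \<in> carrier_mat m m"
    and PP: "P\<^sup>T * P = 1\<^sub>m m"
    and D: "P\<^sup>T * A3 * P = mat m m (\<lambda>(i, j). if i = j then es ! i else 0)" by auto
  let ?F = "four_block_mat (1\<^sub>m 1) (0\<^sub>m 1 m) (0\<^sub>m m 1) P"
  have F: "?F \<in> carrier_mat n n" using P n by auto
  have FT: "?F\<^sup>T = four_block_mat (1\<^sub>m 1) (0\<^sub>m 1 m) (0\<^sub>m m 1) (P\<^sup>T)"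
    using P by (subst transpose_four_block_mat[of _ 1 1 _ m _ m]) auto
  have FTc: "?F\<^sup>T \<in> carrier_mat n n" using F by simp
  have FF: "?F\<^sup>T * ?F = 1\<^sub>m n"
    unfolding FT using P PP
    by (subst mult_four_block_mat[of _ 1 1 _ m _ m _ _ 1 _ m]) (auto simp: n)
  have "?F\<^sup>T * A' * ?F = four_block_mat ?E (0\<^sub>m 1 m) (0\<^sub>m m 1) (P\<^sup>T * A3 * P)"
    unfolding FT block using P A3
    by (simp add: mult_four_block_mat[of _ 1 1 _ m _ m _ _ 1 _ m])
  also have "\<dots> = mat n n (\<lambda>(i, j). if i = j then (e # es) ! i else 0)"
  proof (unfold D, rule eq_matI)
    fix i j assume "i < dim_row (mat n n (\<lambda>(i, j). if i = j then (e # es) ! i else 0))"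
      "j < dim_col (mat n n (\<lambda>(i, j). if i = j then (e # es) ! i else 0))"
    then show "four_block_mat ?E (0\<^sub>m 1 m) (0\<^sub>m m 1) (mat m m (\<lambda>(i, j). if i = j then es ! i else 0)) $$ (i, j)
      = mat n n (\<lambda>(i, j). if i = j then (e # es) ! i else 0) $$ (i, j)"
      by (cases i; cases j) (auto simp: n)
  qed (auto simp: n)
  finally have FAF: "?F\<^sup>T * A' * ?F = mat n n (\<lambda>(i, j). if i = j then (e # es) ! i else 0)" .
  have conj: "(W * F)\<^sup>T * M * (W * F) = F\<^sup>T * (W\<^sup>T * M * W) * F"
    if "F \<in> carrier_mat n n" "M \<in> carrier_mat n n" for F M
    using that W by (simp add: transpose_mult[OF W] assoc_mult_mat[of _ n n _ n _ n])
  \<comment> \<open>Orthogonality of the product is the case of \<open>conj\<close> in which the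
    conjugated matrix is the identity.\<close>
  have "(W * ?F)\<^sup>T * (W * ?F) = 1\<^sub>m n"
    using conj[OF F, of "1\<^sub>m n"] W WT F FTc WW FF
    by (simp only: one_carrier_mat right_mult_one_mat[OF WT] right_mult_one_mat[OF FTc]
        right_mult_one_mat[of "(W * ?F)\<^sup>T" n n] transpose_carrier_mat mult_carrier_mat[OF W F])
  moreover have "(W * ?F)\<^sup>T * A * (W * ?F) = ?F\<^sup>T * A' * ?F"
    using conj[OF F A] by (simp only: A'_def)
  moreover have "W * ?F \<in> carrier_mat n n" using W F by simp
  ultimately show ?case using FAF len n by auto
qed

text \<open>The product of linear factors does not depend on their order, so the diagonalisation
  applies to the very list used in \<open>laplacian_spectrum\<close>.\<close>

lemma real_symmetric_spectral_sorted:
  fixes A :: "real mat"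
  assumes A: "A \<in> carrier_mat n n" and sym: "A\<^sup>T = A"
  defines "es \<equiv> rev (sorted_list_of_multiset (proots (char_poly A)))"
  shows "\<exists>P \<in> carrier_mat n n. P\<^sup>T * P = 1\<^sub>m n \<and>
    P\<^sup>T * A * P = mat n n (\<lambda>(i, j). if i = j then es ! i else 0)"
    "i \<le> j \<Longrightarrow> j < n \<Longrightarrow> es ! j \<le> es ! i"
proof -
  obtain as where as: "char_poly A = (\<Prod>e \<leftarrow> as. [:- e, 1:])"
    using real_symmetric_char_poly_splits[OF A sym] by blast
  have "proots (\<Prod>e \<leftarrow> bs. [:- e, 1:]) = mset bs" for bs :: "real list"
  proof (induction bs)
    case (Cons b bs)
    have "(\<Prod>e \<leftarrow> bs. [:- e, 1:]) \<noteq> 0" by (auto simp: prod_list_zero_iff)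
    then have "proots ([:- b, 1:] * (\<Prod>e \<leftarrow> bs. [:- e, 1:])) = {#b#} + mset bs"
      using Cons by (subst proots_mult) auto
    then show ?case by (simp only: list.map prod_list.Cons mset.simps add_mset_add_single[of b "mset bs"] add.commute)
  qed simp
  then have "proots (char_poly A) = mset as" using as by simp
  then have "mset es = mset as" by (simp add: es_def)
  then have "mset (map (\<lambda>e. [:- e, 1:]) es) = mset (map (\<lambda>e. [:- e, 1:]) as)" by simp
  then have "(\<Prod>e \<leftarrow> es. [:- e, 1:]) = (\<Prod>e \<leftarrow> as. [:- e, 1:])"
    unfolding prod_mset_prod_list[symmetric] by (rule arg_cong)
  with as have cp: "char_poly A = (\<Prod>e \<leftarrow> es. [:- e, 1:])" by simp
  note spec = real_symmetric_spectral[OF A sym cp]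
  then show "\<exists>P \<in> carrier_mat n n. P\<^sup>T * P = 1\<^sub>m n \<and>
    P\<^sup>T * A * P = mat n n (\<lambda>(i, j). if i = j then es ! i else 0)" by blast
  have "sorted (rev es)" by (simp add: es_def)
  then show "es ! j \<le> es ! i" if "i \<le> j" "j < n"
    using that spec by (metis sorted_rev_nth_mono)
qed

section \<open>Variational characterisation of Laplacian eigenvalues\<close>

text \<open>The quadratic form of the Laplacian. An edge is a pair of opposite arcs and is counted
  twice, hence the division by 2.\<close>

definition dirichlet :: "'a pair_pre_digraph \<Rightarrow> ('a \<Rightarrow> real) \<Rightarrow> real" where
  "dirichlet G x =
    (\<Sum>u \<in> pverts G. \<Sum>v \<in> pverts G. of_bool ((u, v) \<in> parcs G) * (x u - x v)\<^sup>2) / 2"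

lemma pair_graph_sym_iff:
  assumes "pair_graph G" shows "(u, v) \<in> parcs G \<longleftrightarrow> (v, u) \<in> parcs G"
proof -
  interpret pair_graph G by fact
  show ?thesis using arcs_symmetric by blast
qed

lemma out_degree_eq_card:
  assumes "pair_graph G"
  shows "out_degree (with_proj G) u = card {v \<in> pverts G. (u, v) \<in> parcs G}"
proof -
  interpret pair_graph G by fact
  have "out_arcs (with_proj G) u = Pair u ` {v \<in> pverts G. (u, v) \<in> parcs G}"
    using in_arcsD2 by (auto simp: out_arcs_def)
  then show ?thesis by (simp add: out_degree_def card_image inj_on_def)
qed

lemma out_degree_eq_sum:
  assumes "pair_graph G"
  shows "real (out_degree (with_proj G) u) = (\<Sum>v \<in> pverts G. of_bool ((u, v) \<in> parcs G))"
proof -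
  interpret pair_graph G by fact
  show ?thesis
    using pair_finite_verts by (simp add: out_degree_eq_card[OF assms] of_bool_def sum.If_cases Int_def)
qed

lemma dirichlet_expand:
  assumes "pair_graph G"
  shows "dirichlet G x = (\<Sum>u \<in> pverts G. real (out_degree (with_proj G) u) * (x u)\<^sup>2)
    - (\<Sum>u \<in> pverts G. \<Sum>v \<in> pverts G. of_bool ((u, v) \<in> parcs G) * (x u * x v))"
proof -
  let ?a = "\<lambda>u v. of_bool ((u, v) \<in> parcs G) :: real"
  have sym: "?a u v = ?a v u" for u v using pair_graph_sym_iff[OF assms] by simp
  have 1: "(\<Sum>u \<in> pverts G. \<Sum>v \<in> pverts G. ?a u v * (x u)\<^sup>2)
      = (\<Sum>u \<in> pverts G. real (out_degree (with_proj G) u) * (x u)\<^sup>2)"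
    by (simp add: out_degree_eq_sum[OF assms] sum_distrib_right)
  have 2: "(\<Sum>u \<in> pverts G. \<Sum>v \<in> pverts G. ?a u v * (x v)\<^sup>2)
      = (\<Sum>u \<in> pverts G. \<Sum>v \<in> pverts G. ?a u v * (x u)\<^sup>2)"
    by (subst sum.swap) (simp add: sym)
  have "(\<Sum>u \<in> pverts G. \<Sum>v \<in> pverts G. ?a u v * (x u - x v)\<^sup>2)
    = (\<Sum>u \<in> pverts G. \<Sum>v \<in> pverts G. ?a u v * (x u)\<^sup>2)
    + (\<Sum>u \<in> pverts G. \<Sum>v \<in> pverts G. ?a u v * (x v)\<^sup>2)
    - 2 * (\<Sum>u \<in> pverts G. \<Sum>v \<in> pverts G. ?a u v * (x u * x v))"
    by (simp add: power2_diff algebra_simps sum.distrib sum_subtractf sum_distrib_left)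
  then show ?thesis unfolding dirichlet_def 1 2 by simp
qed

text \<open>\<open>c x\<close> lists the coordinates of \<open>x\<close> in an orthonormal eigenbasis of the Laplacian.\<close>

definition eigencoordinates ::
  "'a pair_pre_digraph \<Rightarrow> (('a \<Rightarrow> real) \<Rightarrow> nat \<Rightarrow> real) \<Rightarrow> bool" where
  "eigencoordinates G c \<longleftrightarrow>
    (\<forall>x. dirichlet G x =
      (\<Sum>i<card (pverts G). laplacian_spectrum (with_proj G) ! i * (c x i)\<^sup>2)) \<and>
    (\<forall>x y. (\<Sum>v \<in> pverts G. x v * y v) = (\<Sum>i<card (pverts G). c x i * c y i)) \<and>
    (\<forall>z. \<exists>x. \<forall>i<card (pverts G). c x i = z i)"

lemma eigencoordinatesD:
  assumes "eigencoordinates G c"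
  shows "dirichlet G x = (\<Sum>i<card (pverts G). laplacian_spectrum (with_proj G) ! i * (c x i)\<^sup>2)"
    "(\<Sum>v \<in> pverts G. x v * y v) = (\<Sum>i<card (pverts G). c x i * c y i)"
    "\<exists>x. \<forall>i<card (pverts G). c x i = z i"
  using assms by (simp_all add: eigencoordinates_def)

text \<open>If \<open>P\<close> is orthogonal and diagonalises the Laplacian, the coordinates of
  \<open>x\<close> are the entries of \<open>P\<^sup>T\<close> applied to the vector of values of
  \<open>x\<close>. From here on no matrices are needed.\<close>

lemma laplacian_coordinates:
  fixes G :: "'a pair_pre_digraph"
  assumes G: "pair_graph G"
  shows "\<exists>c. eigencoordinates G c"
    and "i \<le> j \<Longrightarrow> j < card (pverts G) \<Longrightarrow>
      laplacian_spectrum (with_proj G) ! j \<le> laplacian_spectrum (with_proj G) ! i"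
proof -
  interpret pair_graph G by fact
  have fin: "finite (pverts G)" by (rule pair_finite_verts)
  define n where "n = card (pverts G)"
  define es where "es = laplacian_spectrum (with_proj G)"
  define vs where "vs = vertex_list (with_proj G)"
  have "distinct vs \<and> set vs = pverts G"
    unfolding vs_def vertex_list_def
    using someI_ex[OF finite_distinct_list[OF fin]] by (simp add: conj_commute)
  then have dist: "distinct vs" and set: "set vs = pverts G" by auto
  have len: "length vs = n" using dist set by (metis distinct_card n_def)
  have bij: "bij_betw ((!) vs) {..<n} (pverts G)"
    using bij_betw_nth[OF dist, of "{..<n}" "pverts G"] len set by simp
  have vsum: "(\<Sum>i<n. f (vs ! i)) = (\<Sum>v \<in> pverts G. f v)" for f :: "'a \<Rightarrow> real"
    using sum.reindex_bij_betw[OF bij] .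
  let ?L = "laplacian_matrix vs (with_proj G)"
  have L: "?L \<in> carrier_mat n n"
    unfolding laplacian_matrix_def
    by (intro minus_carrier_mat) (simp add: adjacency_matrix_def len)
  have Lij: "?L $$ (i, j) = of_bool (i = j) * real (out_degree (with_proj G) (vs ! i))
      - of_bool ((vs ! i, vs ! j) \<in> parcs G)" if "i < n" "j < n" for i j
    using that by (simp add: laplacian_matrix_def degree_matrix_def adjacency_matrix_def len)
  have LT: "?L\<^sup>T = ?L"
    by (rule eq_matI) (use L in \<open>auto simp: Lij pair_graph_sym_iff[OF G]\<close>)
  have es_eq: "es = rev (sorted_list_of_multiset (proots (char_poly ?L)))"
    by (simp add: es_def laplacian_spectrum_def vs_def)
  note spec = real_symmetric_spectral_sorted[OF L LT, folded es_eq]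
  show "laplacian_spectrum (with_proj G) ! j \<le> laplacian_spectrum (with_proj G) ! i"
    if "i \<le> j" "j < card (pverts G)"
    using spec(2) that by (simp add: es_def n_def)
  obtain P where P: "P \<in> carrier_mat n n" and PP: "P\<^sup>T * P = 1\<^sub>m n"
    and D: "P\<^sup>T * ?L * P = mat n n (\<lambda>(i, j). if i = j then es ! i else 0)"
    using spec(1) by blast
  have PT: "P\<^sup>T \<in> carrier_mat n n" using P by simp
  have PP': "P * P\<^sup>T = 1\<^sub>m n" using mat_mult_left_right_inverse[OF PT P PP] .
  define w where "w = (\<lambda>x :: 'a \<Rightarrow> real. vec n (\<lambda>i. x (vs ! i)))"
  define C where "C = (\<lambda>x. P\<^sup>T *\<^sub>v w x)"
  have wc: "w x \<in> carrier_vec n" for x by (simp add: w_def)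
  have Cc: "C x \<in> carrier_vec n" for x using P wc by (simp add: C_def)
  have wC: "w x = P *\<^sub>v C x" for x
    unfolding C_def using assoc_mult_mat_vec[OF P PT wc, of x] PP' wc by simp
  have inner: "w x \<bullet> (M *\<^sub>v w y) = C x \<bullet> ((P\<^sup>T * M * P) *\<^sub>v C y)" if M: "M \<in> carrier_mat n n" for M x y
  proof -
    have "w x \<bullet> (M *\<^sub>v w y) = (P\<^sup>T\<^sup>T *\<^sub>v C x) \<bullet> (M *\<^sub>v w y)" using wC by simp
    also have "\<dots> = C x \<bullet> (P\<^sup>T *\<^sub>v (M *\<^sub>v w y))"
      using transpose_vec_mult_scalar[OF PT _ Cc] M wc by (metis mult_mat_vec_carrier)
    also have "P\<^sup>T *\<^sub>v (M *\<^sub>v w y) = (P\<^sup>T * M * P) *\<^sub>v C y"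
      unfolding wC[of y] using M P PT Cc[of y]
      by (simp add: assoc_mult_mat_vec[of _ n n _ n] assoc_mult_mat[of _ n n _ n _ n])
    finally show ?thesis .
  qed
  have "dirichlet G x = (\<Sum>i<n. es ! i * (C x $ i)\<^sup>2)" for x
  proof -
    have "w x \<bullet> (?L *\<^sub>v w x) = (\<Sum>i<n. \<Sum>j<n. x (vs ! i) * ?L $$ (i, j) * x (vs ! j))"
      using L by (simp add: w_def scalar_prod_def atLeast0LessThan sum_distrib_left mult.assoc)
    also have "\<dots> = (\<Sum>i<n. (\<Sum>j<n. of_bool (i = j) * (real (out_degree (with_proj G) (vs ! i)) * (x (vs ! i))\<^sup>2))
       - (\<Sum>j<n. of_bool ((vs ! i, vs ! j) \<in> parcs G) * (x (vs ! i) * x (vs ! j))))"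
      unfolding sum_subtractf[symmetric]
      by (intro sum.cong refl) (auto simp: Lij algebra_simps power2_eq_square)
    also have "\<dots> = dirichlet G x"
      unfolding dirichlet_expand[OF G] vsum[symmetric] sum_subtractf
      by (simp add: of_bool_def if_distrib[of "\<lambda>b. b * _"] cong: if_cong)
    finally have "dirichlet G x = C x \<bullet> (mat n n (\<lambda>(i, j). if i = j then es ! i else 0) *\<^sub>v C x)"
      using inner[OF L] D by simp
    also have "\<dots> = (\<Sum>i<n. es ! i * (C x $ i)\<^sup>2)"
      using Cc[of x] by (simp add: scalar_prod_def atLeast0LessThan if_distrib[of "\<lambda>b. b * _"]
          power2_eq_square mult.left_commute cong: if_cong)
    finally show ?thesis .
  qed
  moreover have "(\<Sum>v \<in> pverts G. x v * y v) = (\<Sum>i<n. C x $ i * C y $ i)" for x y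
  proof -
    have "(\<Sum>v \<in> pverts G. x v * y v) = w x \<bullet> (1\<^sub>m n *\<^sub>v w y)"
      unfolding vsum[symmetric] by (simp add: w_def scalar_prod_def atLeast0LessThan)
    also have "\<dots> = C x \<bullet> C y" using inner[of "1\<^sub>m n" x y] P PT PP Cc by simp
    finally show ?thesis using Cc[of y] by (simp add: scalar_prod_def atLeast0LessThan)
  qed
  moreover have "\<exists>x. \<forall>i<n. C x $ i = z i" for z
  proof -
    \<comment> \<open>Prescribed coordinates \<open>z\<close> belong to the vector
      \<open>P z\<close>, read back as a function on vertices through the enumeration
      \<open>vs\<close>.\<close>
    define x where "x = (\<lambda>v. (P *\<^sub>v vec n z) $ (the_inv_into {..<n} ((!) vs) v))"
    have "w x = P *\<^sub>v vec n z"
      using P bij by (intro eq_vecI) (auto simp: w_def x_def the_inv_into_f_f bij_betw_def)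
    then have "C x = vec n z"
      unfolding C_def using assoc_mult_mat_vec[OF PT P, of "vec n z"] PP by simp
    then show ?thesis by (intro exI[of _ x]) simp
  qed
  ultimately have "eigencoordinates G (\<lambda>x i. C x $ i)"
    unfolding eigencoordinates_def es_def n_def by blast
  then show "\<exists>c. eigencoordinates G c" by blast
qed

lemma dirichlet_nonneg: "0 \<le> dirichlet G x"
  by (auto simp: dirichlet_def intro!: sum_nonneg)

lemma dirichlet_le_largest:
  assumes G: "pair_graph G"
  shows "dirichlet G x \<le> laplacian_eigenvalue (with_proj G) 1 * (\<Sum>v \<in> pverts G. (x v)\<^sup>2)"
proof -
  define n where "n = card (pverts G)"
  let ?e = "\<lambda>i. laplacian_spectrum (with_proj G) ! i"
  obtain c where c: "eigencoordinates G c" using laplacian_coordinates(1)[OF G] by blast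
  note c = eigencoordinatesD[OF c, unfolded n_def[symmetric]] laplacian_coordinates(2)[OF G, unfolded n_def[symmetric]]
  show ?thesis unfolding c(1) power2_eq_square c(2) laplacian_eigenvalue_def sum_distrib_left
    using c(4) by (auto intro!: sum_mono mult_right_mono)
qed

text \<open>The hypothesis is tested on a unit eigenvector of the first eigenvalue.\<close>

lemma largest_le:
  assumes G: "pair_graph G" and ne: "pverts G \<noteq> {}"
    and le: "\<And>x. dirichlet G x \<le> r * (\<Sum>v \<in> pverts G. (x v)\<^sup>2)"
  shows "laplacian_eigenvalue (with_proj G) 1 \<le> r"
proof -
  interpret pair_graph G by fact
  define n where "n = card (pverts G)"
  have n: "0 < n" using ne pair_finite_verts by (simp add: n_def card_gt_0_iff)
  let ?e = "\<lambda>i. laplacian_spectrum (with_proj G) ! i"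
  obtain c where c: "eigencoordinates G c" using laplacian_coordinates(1)[OF G] by blast
  note c = eigencoordinatesD[OF c, unfolded n_def[symmetric]] laplacian_coordinates(2)[OF G, unfolded n_def[symmetric]]
  obtain x where x: "\<forall>i<n. c x i = of_bool (i = 0)" using c(3)[of "\<lambda>i. of_bool (i = 0)"] by blast
  have "(\<Sum>i<n. f i * (c x i)\<^sup>2) = f 0" for f :: "nat \<Rightarrow> real"
  proof -
    have "(\<Sum>i<n. f i * (c x i)\<^sup>2) = (\<Sum>i<n. if i = 0 then f i else 0)"
      using x by (intro sum.cong) auto
    also have "\<dots> = f 0" using n by (simp add: sum.delta)
    finally show ?thesis .
  qed
  from this[of "\<lambda>i. laplacian_spectrum (with_proj G) ! i"] this[of "\<lambda>_. 1"]
  show ?thesis using le[of x] c(1)[of x] c(2)[of x x]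
    by (simp add: power2_eq_square laplacian_eigenvalue_def)
qed

text \<open>When \<open>?l\<close> is positive, the all-ones vector, having zero energy, has zero
  coordinates except the last one. A vector orthogonal to it then has last coordinate 0, and only
  eigenvalues at least \<open>?l\<close> contribute to its energy.\<close>

lemma second_smallest_le_dirichlet:
  assumes G: "pair_graph G" and n: "card (pverts G) = n" "2 \<le> n"
    and x: "(\<Sum>v \<in> pverts G. x v) = 0"
  shows "laplacian_eigenvalue (with_proj G) (n - 1) * (\<Sum>v \<in> pverts G. (x v)\<^sup>2) \<le> dirichlet G x"
proof -
  let ?e = "\<lambda>i. laplacian_spectrum (with_proj G) ! i"
  obtain c where c: "eigencoordinates G c" using laplacian_coordinates(1)[OF G] by blast
  note c = eigencoordinatesD[OF c, unfolded n(1)] laplacian_coordinates(2)[OF G, unfolded n(1)]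
  let ?l = "?e (n - 2)"
  have l: "laplacian_eigenvalue (with_proj G) (n - 1) = ?l"
    using n(2) by (simp add: laplacian_eigenvalue_def numeral_2_eq_2)
  show ?thesis
  \<comment> \<open>For nonpositive \<open>?l\<close> the claim is just nonnegativity of the
    form.\<close>
  proof (cases "?l \<le> 0")
    case True
    then have "?l * (\<Sum>v \<in> pverts G. (x v)\<^sup>2) \<le> 0"
      by (intro mult_nonpos_nonneg sum_nonneg) auto
    then show ?thesis using dirichlet_nonneg[of G x] unfolding l by linarith
  next
    case False
    have pos: "?e i > 0" if "i < n - 1" for i
    proof -
      have "i \<le> n - 2" "n - 2 < n" using that n(2) by auto
      from c(4)[OF this] show ?thesis using False by simp
    qed
    have last: "?e (n - 1) \<ge> 0"
    proof -
      obtain y where y: "\<forall>i<n. c y i = of_bool (i = n - 1)" using c(3)[of "\<lambda>i. of_bool (i = n - 1)"] by blast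
      have "dirichlet G y = (\<Sum>i<n. if i = n - 1 then ?e i else 0)"
        unfolding c(1) using y by (intro sum.cong) auto
      also have "\<dots> = ?e (n - 1)" using n by simp
      finally show ?thesis using dirichlet_nonneg[of G y] by simp
    qed
    let ?o = "\<lambda>_ :: 'a. 1 :: real"
    have "dirichlet G ?o = 0" by (simp add: dirichlet_def)
    then have "(\<Sum>i<n. ?e i * (c ?o i)\<^sup>2) = 0" using c(1) by simp
    moreover have "?e i \<ge> 0" if "i < n" for i
      using pos[of i] last that by (cases "i = n - 1") (auto simp: less_eq_real_def)
    ultimately have "\<forall>i\<in>{..<n}. ?e i * (c ?o i)\<^sup>2 = 0"
      by (subst (asm) sum_nonneg_eq_0_iff) auto
    then have o: "c ?o i = 0" if "i < n - 1" for i
      using pos[OF that] that by (metis diff_le_self lessThan_iff less_irrefl mult_eq_0_iff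
          order_less_le_trans power_eq_0_iff)
    have split: "(\<Sum>i<n. f i) = (\<Sum>i<n-1. f i) + f (n - 1)" for f :: "nat \<Rightarrow> real"
      using n(2) by (cases n) auto
    have "real n = (c ?o (n - 1))\<^sup>2"
      using c(2)[of ?o ?o] n(1) o unfolding split by (simp add: power2_eq_square)
    then have o1: "c ?o (n - 1) \<noteq> 0" using n(2) by auto
    have "c x (n - 1) * c ?o (n - 1) = 0"
      using c(2)[of x ?o] x o unfolding split by simp
    with o1 have x0: "c x (n - 1) = 0" by simp
    have "?l * (\<Sum>i<n-1. c x i * c x i) \<le> (\<Sum>i<n-1. ?e i * (c x i)\<^sup>2)"
      unfolding sum_distrib_left power2_eq_square using n(2)
      by (intro sum_mono mult_right_mono c(4)) auto
    then show ?thesis unfolding l c(1) power2_eq_square[of "x _"] c(2) split x0 by simp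
  qed
qed

text \<open>The Courant-Fischer argument: the span of eigenvectors for the two smallest eigenvalues
  is two-dimensional, so it contains a nonzero vector orthogonal to the all-ones vector, on which
  the form is at most \<open>?e m\<close> times the squared norm.\<close>

lemma le_second_smallest:
  assumes G: "pair_graph G" and n: "card (pverts G) = n" "2 \<le> n"
    and le: "\<And>x. (\<Sum>v \<in> pverts G. x v) = 0 \<Longrightarrow> r * (\<Sum>v \<in> pverts G. (x v)\<^sup>2) \<le> dirichlet G x"
  shows "r \<le> laplacian_eigenvalue (with_proj G) (n - 1)"
proof -
  let ?e = "\<lambda>i. laplacian_spectrum (with_proj G) ! i"
  obtain c where c: "eigencoordinates G c" using laplacian_coordinates(1)[OF G] by blast
  note c = eigencoordinatesD[OF c, unfolded n(1)] laplacian_coordinates(2)[OF G, unfolded n(1)]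
  obtain m where m: "n = Suc (Suc m)" using n(2) by (metis add_2_eq_Suc le_Suc_ex)
  let ?o = "\<lambda>_ :: 'a. 1 :: real"
  define p q where "p = c ?o m" and "q = c ?o (Suc m)"
  obtain a b where ab: "a * p + b * q = 0" "a \<noteq> 0 \<or> b \<noteq> 0"
  proof (cases "p = 0 \<and> q = 0")
    case True with that[of 1 0] show ?thesis by simp
  next
    case False with that[of q "- p"] show ?thesis by auto
  qed
  obtain x where x: "\<forall>i<n. c x i = (if i = m then a else if i = Suc m then b else 0)"
    using c(3)[of "\<lambda>i. if i = m then a else if i = Suc m then b else 0"] by blast
  have xs: "(\<Sum>i<n. f i (c x i)) = f m a + f (Suc m) b" if "\<And>i. f i 0 = 0" for f :: "nat \<Rightarrow> real \<Rightarrow> real"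
    using x that by (simp add: m)
  have "(\<Sum>v \<in> pverts G. x v) = 0"
    using c(2)[of x ?o] xs[of "\<lambda>i t. t * c ?o i"] ab(1) by (simp add: p_def q_def)
  from le[OF this] have "r * (a\<^sup>2 + b\<^sup>2) \<le> ?e m * a\<^sup>2 + ?e (Suc m) * b\<^sup>2"
    using c(2)[of x x] xs[of "\<lambda>i t. t * t"] c(1)[of x] xs[of "\<lambda>i t. ?e i * t\<^sup>2"]
    by (simp add: power2_eq_square)
  also have "\<dots> \<le> ?e m * (a\<^sup>2 + b\<^sup>2)"
    using mult_right_mono[OF c(4)[of m "Suc m"], of "b\<^sup>2"] by (simp add: m algebra_simps)
  moreover have "0 < a\<^sup>2 + b\<^sup>2" using ab(2) by (simp add: sum_power2_gt_zero_iff)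
  ultimately have "r \<le> ?e m" by (meson mult_le_cancel_right_pos order_trans)
  then show ?thesis by (simp add: m laplacian_eigenvalue_def)
qed

section \<open>Test vectors constant on the parts of a separation\<close>

text \<open>Subtracting the mean preserves the energy, and \<open>W\<close> is \<open>n\<close>
  times the squared norm of the centred vector. Test vectors therefore need not be centred
  beforehand.\<close>

lemma dirichlet_centered_bounds:
  fixes x :: "'a \<Rightarrow> real"
  assumes G: "pair_graph G" and n: "card (pverts G) = n" "2 \<le> n"
  defines "W \<equiv> real n * (\<Sum>v \<in> pverts G. (x v)\<^sup>2) - (\<Sum>v \<in> pverts G. x v)\<^sup>2"
  shows "laplacian_eigenvalue (with_proj G) (n - 1) * W \<le> real n * dirichlet G x"
    and "real n * dirichlet G x \<le> laplacian_eigenvalue (with_proj G) 1 * W"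
proof -
  define t where "t = (\<Sum>v \<in> pverts G. x v) / real n"
  have X: "(\<Sum>v \<in> pverts G. x v) = real n * t" using n(2) by (simp add: t_def)
  define y where "y = (\<lambda>v. x v - t)"
  have dy: "dirichlet G y = dirichlet G x" by (simp add: dirichlet_def y_def)
  have "(\<Sum>v \<in> pverts G. (y v)\<^sup>2) = (\<Sum>v \<in> pverts G. (x v)\<^sup>2) - 2 * t * (\<Sum>v \<in> pverts G. x v) + real n * t\<^sup>2"
    by (simp add: y_def power2_diff sum.distrib sum_subtractf sum_distrib_left n(1) mult_ac)
  then have "(\<Sum>v \<in> pverts G. (x v)\<^sup>2) = (\<Sum>v \<in> pverts G. (y v)\<^sup>2) + real n * t\<^sup>2"
    by (simp add: X power2_eq_square)
  then have W: "W = real n * (\<Sum>v \<in> pverts G. (y v)\<^sup>2)"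
    by (simp add: W_def X algebra_simps power2_eq_square)
  have "(\<Sum>v \<in> pverts G. y v) = 0" by (simp add: y_def sum_subtractf n(1) X)
  from second_smallest_le_dirichlet[OF G n this]
  show "laplacian_eigenvalue (with_proj G) (n - 1) * W \<le> real n * dirichlet G x"
    using n(2) by (simp add: W dy mult.left_commute[of _ "real n"])
  from dirichlet_le_largest[OF G, of y]
  show "real n * dirichlet G x \<le> laplacian_eigenvalue (with_proj G) 1 * W"
    using n(2) by (simp add: W dy mult.left_commute[of _ "real n"])
qed

section \<open>Edge counts across a cut and the separation estimates\<close>

definition cut_size :: "'a pair_pre_digraph \<Rightarrow> 'a set \<Rightarrow> 'a set \<Rightarrow> real" where
  "cut_size G X Y = (\<Sum>u \<in> X. \<Sum>v \<in> Y. of_bool ((u, v) \<in> parcs G))"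

lemma cut_size_commute:
  assumes "pair_graph G" shows "cut_size G X Y = cut_size G Y X"
  unfolding cut_size_def by (subst sum.swap) (simp add: pair_graph_sym_iff[OF assms])

lemma cut_size_le:
  shows "cut_size G X Y \<le> real (card X) * real (card Y)"
proof -
  have "cut_size G X Y \<le> (\<Sum>u \<in> X. \<Sum>v \<in> Y. 1)"
    unfolding cut_size_def by (intro sum_mono) auto
  then show ?thesis by simp
qed

text \<open>A single missing pair makes the count strictly smaller. This turns a tight eigenvalue
  estimate into adjacency of all pairs.\<close>

lemma cut_size_full:
  assumes "finite X" "finite Y" "real (card X) * real (card Y) \<le> cut_size G X Y" "u \<in> X" "v \<in> Y"
  shows "(u, v) \<in> parcs G"
proof (rule ccontr)
  assume n: "(u, v) \<notin> parcs G"
  have "(\<Sum>v \<in> Y. of_bool ((u, v) \<in> parcs G)) < (\<Sum>v \<in> Y. 1 :: real)"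
    using assms n by (intro sum_strict_mono_ex1 bexI[of _ v]) auto
  moreover have "(\<Sum>v \<in> Y. of_bool ((w, v) \<in> parcs G)) \<le> (\<Sum>v \<in> Y. 1 :: real)" for w
    by (intro sum_mono) auto
  ultimately have "cut_size G X Y < (\<Sum>u \<in> X. \<Sum>v \<in> Y. 1)"
    unfolding cut_size_def using assms(1,4) by (intro sum_strict_mono_ex1) blast+
  with assms(3) show False by simp
qed

lemma cut_size_complete:
  assumes "\<And>u v. u \<in> X \<Longrightarrow> v \<in> Y \<Longrightarrow> (u, v) \<in> parcs G"
  shows "cut_size G X Y = real (card X) * real (card Y)"
  using assms by (simp add: cut_size_def)

text \<open>The parts may be empty; \<open>B = {}\<close> yields the estimates for a single set
  against its complement.\<close>

locale graph_separation =
  fixes G :: "'a pair_pre_digraph" and A B S :: "'a set" and n :: nat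
  assumes G: "pair_graph G"
    and verts: "pverts G = A \<union> B \<union> S"
    and disj: "A \<inter> B = {}" "A \<inter> S = {}" "B \<inter> S = {}"
    and no_arcs: "\<And>u v. u \<in> A \<Longrightarrow> v \<in> B \<Longrightarrow> (u, v) \<notin> parcs G"
    and n: "card (pverts G) = n" "2 \<le> n"
begin

abbreviation "mu \<equiv> laplacian_eigenvalue (with_proj G) 1"
abbreviation "lam \<equiv> laplacian_eigenvalue (with_proj G) (n - 1)"

lemma fin: "finite A" "finite B" "finite S"
proof -
  interpret pair_graph G by (rule G)
  show "finite A" "finite B" "finite S" using pair_finite_verts verts by auto
qed

lemma sum_blocks: "(\<Sum>v \<in> pverts G. f v) = (\<Sum>v \<in> A. f v) + (\<Sum>v \<in> B. f v) + (\<Sum>v \<in> S. f v :: real)"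
  using fin disj unfolding verts by (simp add: sum.union_disjoint Int_Un_distrib2)

lemma n_eq: "real n = real (card A) + real (card B) + real (card S)"
  using sum_blocks[of "\<lambda>_. 1"] n by simp

lemma dirichlet_blocks:
  assumes "\<And>v. v \<in> A \<Longrightarrow> x v = p" "\<And>v. v \<in> B \<Longrightarrow> x v = q" "\<And>v. v \<in> S \<Longrightarrow> x v = 0"
  shows "dirichlet G x = p\<^sup>2 * cut_size G A S + q\<^sup>2 * cut_size G B S"
proof -
  have no_arcs': "(v, u) \<notin> parcs G" if "u \<in> A" "v \<in> B" for u v
    using no_arcs[OF that] pair_graph_sym_iff[OF G] by blast
  have "2 * dirichlet G x = p\<^sup>2 * cut_size G A S + q\<^sup>2 * cut_size G B S + (p\<^sup>2 * cut_size G S A + q\<^sup>2 * cut_size G S B)"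
    unfolding dirichlet_def sum_blocks
    by (simp add: assms no_arcs no_arcs' cut_size_def sum_distrib_left sum.distrib mult.commute)
  then show ?thesis using cut_size_commute[OF G, of S A] cut_size_commute[OF G, of S B] by (simp add: mult.commute)
qed

text \<open>The centred bounds for the vector that is \<open>p\<close> on \<open>A\<close>,
  \<open>q\<close> on \<open>B\<close> and 0 on \<open>S\<close>. All later estimates come from
  special choices of \<open>p\<close> and \<open>q\<close>.\<close>

lemma block_bounds:
  fixes p q :: real
  defines "W \<equiv> real n * (p\<^sup>2 * real (card A) + q\<^sup>2 * real (card B)) - (p * real (card A) + q * real (card B))\<^sup>2"
  shows "lam * W \<le> real n * (p\<^sup>2 * cut_size G A S + q\<^sup>2 * cut_size G B S)"
    and "real n * (p\<^sup>2 * cut_size G A S + q\<^sup>2 * cut_size G B S) \<le> mu * W"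
proof -
  define x where "x = (\<lambda>v. if v \<in> A then p else if v \<in> B then q else 0)"
  have x: "\<And>v. v \<in> A \<Longrightarrow> x v = p" "\<And>v. v \<in> B \<Longrightarrow> x v = q" "\<And>v. v \<in> S \<Longrightarrow> x v = 0"
    using disj by (auto simp: x_def)
  have "(\<Sum>v \<in> pverts G. (x v)\<^sup>2) = p\<^sup>2 * real (card A) + q\<^sup>2 * real (card B)"
    "(\<Sum>v \<in> pverts G. x v) = p * real (card A) + q * real (card B)"
    unfolding sum_blocks by (simp_all add: x mult.commute)
  then show "lam * W \<le> real n * (p\<^sup>2 * cut_size G A S + q\<^sup>2 * cut_size G B S)"
    and "real n * (p\<^sup>2 * cut_size G A S + q\<^sup>2 * cut_size G B S) \<le> mu * W"
    using dirichlet_centered_bounds[OF G n, of x] by (simp_all add: W_def dirichlet_blocks[OF x])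
qed

text \<open>The choices \<open>(1, -1)\<close> and \<open>(1, 1)\<close> have the same energy; the
  first bounds it from below by \<open>lam\<close>, the second from above by
  \<open>mu\<close>.\<close>

lemma split_bound:
  "lam * ((real (card A) + real (card B)) * real (card S) + 4 * real (card A) * real (card B))
    \<le> mu * real (card S) * (real (card A) + real (card B))"
proof -
  have "lam * ((real (card A) + real (card B)) * real (card S) + 4 * real (card A) * real (card B))
     \<le> real n * (cut_size G A S + cut_size G B S)"
    using block_bounds(1)[of 1 "-1"] by (simp add: n_eq power2_eq_square algebra_simps)
  also have "\<dots> \<le> mu * real (card S) * (real (card A) + real (card B))"
    using block_bounds(2)[of 1 1] by (simp add: n_eq power2_eq_square algebra_simps)
  finally show ?thesis .
qed

lemma join_imp_largest_ge:
  assumes "\<And>u v. u \<in> A \<union> B \<Longrightarrow> v \<in> S \<Longrightarrow> (u, v) \<in> parcs G" "A \<noteq> {}" "S \<noteq> {}"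
  shows "real n \<le> mu"
proof -
  have "cut_size G A S = real (card A) * real (card S)" "cut_size G B S = real (card B) * real (card S)"
    using assms by (auto intro: cut_size_complete)
  with block_bounds(2)[of 1 1]
  have "real n * ((real (card A) + real (card B)) * real (card S))
      \<le> mu * ((real (card A) + real (card B)) * real (card S))"
    by (simp add: n_eq power2_eq_square algebra_simps)
  moreover have "0 < (real (card A) + real (card B)) * real (card S)"
    using assms(2,3) fin by (simp add: card_gt_0_iff add_pos_nonneg)
  ultimately show ?thesis by (simp add: mult_le_cancel_right)
qed

text \<open>With \<open>p = b\<close> and \<open>q = - a\<close> the test vector has mean zero,
  squared norm \<open>a * b * (a + b)\<close>, and energy at most \<open>s\<close> times
  that.\<close>

lemma lam_le_separator:
  assumes ne: "A \<noteq> {}" "B \<noteq> {}"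
  shows "lam \<le> real (card S)"
    and "real (card S) \<le> lam \<Longrightarrow> u \<in> A \<union> B \<Longrightarrow> v \<in> S \<Longrightarrow> (u, v) \<in> parcs G"
proof -
  define a b s where "a = real (card A)" and "b = real (card B)" and "s = real (card S)"
  have pos: "a > 0" "b > 0" using ne fin by (auto simp: a_def b_def card_gt_0_iff)
  have eA: "cut_size G A S \<le> a * s" and eB: "cut_size G B S \<le> b * s"
    using cut_size_le by (auto simp: a_def b_def s_def)
  have "real n * (lam * (a * b * (a + b))) \<le> real n * (b\<^sup>2 * cut_size G A S + a\<^sup>2 * cut_size G B S)"
    using block_bounds(1)[of b "- a"] unfolding a_def[symmetric] b_def[symmetric]
    by (simp add: power2_eq_square algebra_simps)
  then have *: "lam * (a * b * (a + b)) \<le> b\<^sup>2 * cut_size G A S + a\<^sup>2 * cut_size G B S"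
    using n(2) by simp
  have 1: "b\<^sup>2 * cut_size G A S \<le> b\<^sup>2 * (a * s)" "a\<^sup>2 * cut_size G B S \<le> a\<^sup>2 * (b * s)"
    using eA eB by (auto intro: mult_left_mono)
  have "lam * (a * b * (a + b)) \<le> s * (a * b * (a + b))"
    using * 1 by (simp add: power2_eq_square algebra_simps)
  then show "lam \<le> real (card S)" using pos by (simp add: s_def mult_le_cancel_right)
  assume "real (card S) \<le> lam"
  then have "s * (a * b * (a + b)) \<le> lam * (a * b * (a + b))"
    using pos by (intro mult_right_mono) (auto simp: s_def)
  then have "s * (a * b * (a + b)) \<le> b\<^sup>2 * cut_size G A S + a\<^sup>2 * cut_size G B S" using * by simp
  \<comment> \<open>The sum of the two upper bounds in \<open>1\<close> is attained, so each of them
    is tight.\<close>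
  then have "b\<^sup>2 * (a * s) \<le> b\<^sup>2 * cut_size G A S" "a\<^sup>2 * (b * s) \<le> a\<^sup>2 * cut_size G B S"
    using 1 by (simp_all add: power2_eq_square algebra_simps)
  then have "a * s \<le> cut_size G A S" "b * s \<le> cut_size G B S" using pos by simp_all
  then show "(u, v) \<in> parcs G" if "u \<in> A \<union> B" "v \<in> S"
    using that fin unfolding a_def b_def s_def by (auto intro: cut_size_full)
qed

end

text \<open>The ratio bound for independent sets, before degrees are replaced by the minimum degree:
  test with the indicator of \<open>I\<close>, whose cut to the complement is its degree sum. The
  form with actual degrees is needed for (B).\<close>

lemma independent_degree_sum_bound:
  assumes G: "pair_graph G" and n: "card (pverts G) = n" "2 \<le> n"
    and I: "I \<subseteq> pverts G" "\<And>u v. u \<in> I \<Longrightarrow> v \<in> I \<Longrightarrow> (u, v) \<notin> parcs G"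
  shows "real n * (\<Sum>u \<in> I. real (out_degree (with_proj G) u))
    \<le> laplacian_eigenvalue (with_proj G) 1 * (real (card I) * (real n - real (card I)))"
proof -
  interpret graph_separation G I "{}" "pverts G - I" n
    using assms by (intro graph_separation.intro) auto
  have "cut_size G I (pverts G - I) = (\<Sum>u \<in> I. real (out_degree (with_proj G) u))"
    unfolding cut_size_def out_degree_eq_sum[OF G]
    using I fin verts by (intro sum.cong refl sum.mono_neutral_left) auto
  then show ?thesis using block_bounds(2)[of 1 0]
    by (simp add: n_eq power2_eq_square algebra_simps)
qed

section \<open>Components of induced subgraphs\<close>

lemma strongly_connected_imp_connected:
  assumes "strongly_connected K" shows "Digraph_Component.connected K"
  using assms unfolding connected_conv strongly_connected_def reachable_def
  using rtrancl_on_mono[of "arcs_ends K" "(arcs_ends K)\<^sup>s" "verts K" "verts K"]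
  by (auto simp: symcl_def)

text \<open>Connectedness and strong connectedness agree on symmetric subgraphs. This relates
  \<open>num_components\<close> to strongly connected components, hence to reachability.\<close>

lemma (in sym_digraph) max_connected_iff_scc:
  "max_subgraph Digraph_Component.connected C \<longleftrightarrow> C \<in> sccs"
proof
  have mono: "arc_mono Digraph_Component.connected"
    unfolding arc_mono_def
    by (metis spanning_def subgraphE wf_digraph.connected_spanning_imp_connected)
  assume max: "max_subgraph Digraph_Component.connected C"
  then have ind: "induced_subgraph C G" using induced_subgraphI_arc_mono mono by blast
  then have "symmetric C" using induced_graph_imp_symmetric sym_arcs by blast
  moreover have "wf_digraph C" using ind by (rule wf_digraphI_induced)
  ultimately have "strongly_connected C"
    using max max_subgraph_prop wf_digraph.symmetric_connected_imp_strongly_connected by blast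
  then have "max_subgraph strongly_connected C"
    using max_subgraph_mp[OF max] strongly_connected_imp_connected by blast
  then show "C \<in> sccs" by (simp add: sccs_altdef2)
next
  assume C: "C \<in> sccs"
  then have max: "max_subgraph strongly_connected C" by (simp add: sccs_altdef2)
  show "max_subgraph Digraph_Component.connected C"
  proof (rule max_subgraphI)
    show "Digraph_Component.connected C"
      using max max_subgraph_prop strongly_connected_imp_connected by blast
    show "subgraph C G" using max by (rule subgraphI_max_subgraph)
    fix y assume y: "C \<noteq> y" "subgraph C y" "subgraph y G"
    show "\<not> Digraph_Component.connected y"
    proof
      assume con: "Digraph_Component.connected y"
      \<comment> \<open>The subgraph \<open>y\<close> need not be symmetric, so it is enlarged to
        the subgraph induced on its vertices, where connected implies strongly connected.\<close>
      let ?K = "G \<restriction> verts y"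
      have vy: "verts y \<subseteq> verts G" using y(3) by auto
      then have ind: "induced_subgraph ?K G" by (rule induced_induce)
      have yK: "subgraph y ?K" using y(3) by (rule subgraph_induce_subgraphI2)
      interpret K: wf_digraph ?K using ind by (rule wf_digraphI_induced)
      have "Digraph_Component.connected ?K"
        using con yK by (intro K.connected_spanning_imp_connected[of y]) (auto simp: spanning_def)
      moreover have "symmetric ?K" using induced_graph_imp_symmetric[OF sym_arcs ind] .
      ultimately have "strongly_connected ?K" by (intro K.symmetric_connected_imp_strongly_connected)
      moreover have CK: "subgraph C ?K" using y(2) yK subgraph_trans by blast
      moreover have "subgraph ?K G" using ind by auto
      ultimately have "?K = C" using max unfolding max_subgraph_def by blast
      then have "subgraph y C" using yK by simp
      with y(2) have "y = C" by (auto simp: subgraph_def compatible_def intro!: pre_digraph.equality)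
      with y(1) show False by simp
    qed
  qed
qed

lemma (in sym_digraph) sccs_verts_eq: "sccs_verts = (\<lambda>u. {v. u \<rightarrow>\<^sup>* v}) ` verts G"
proof -
  have sym: "u \<rightarrow>\<^sup>* v \<longleftrightarrow> v \<rightarrow>\<^sup>* u" for u v using symmetric_reachable[OF sym_arcs] by blast
  show ?thesis
  proof (intro subset_antisym subsetI)
    fix X assume X: "X \<in> sccs_verts"
    then obtain u where u: "u \<in> X" by (auto simp: sccs_verts_def)
    with X have "u \<rightarrow>\<^sup>* u" by (auto simp: sccs_verts_def)
    then have "u \<in> verts G" by (auto elim: reachable_in_vertsE)
    moreover have "u \<rightarrow>\<^sup>* v \<longleftrightarrow> v \<in> X" for v
      using X u sym[of u v] unfolding sccs_verts_def by blast
    then have "X = {v. u \<rightarrow>\<^sup>* v}" by auto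
    ultimately show "X \<in> (\<lambda>u. {v. u \<rightarrow>\<^sup>* v}) ` verts G" by blast
  next
    fix X assume "X \<in> (\<lambda>u. {v. u \<rightarrow>\<^sup>* v}) ` verts G"
    then obtain u where u: "u \<in> verts G" "X = {v. u \<rightarrow>\<^sup>* v}" by auto
    then show "X \<in> sccs_verts"
      using reachable_trans sym unfolding sccs_verts_def by (auto intro: reachable_refl) blast+
  qed
qed

text \<open>The label \<open>f u\<close> is the set of vertices reachable from \<open>u\<close> in
  the induced subgraph. Later arguments use only the stated properties of this labelling and never
  return to reachability.\<close>

lemma num_components_classes:
  assumes "pair_graph G" "T \<subseteq> pverts G"
  shows "\<exists>f :: 'a \<Rightarrow> 'a set. num_components (with_proj G \<restriction> T) = card (f ` T) \<and>
    (\<forall>u \<in> T. \<forall>v \<in> T. (u, v) \<in> parcs G \<longrightarrow> f u = f v) \<and>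
    ((\<forall>u \<in> T. \<forall>v \<in> T. (u, v) \<notin> parcs G) \<longrightarrow> inj_on f T)"
proof -
  interpret pair_graph G by fact
  let ?K = "with_proj G \<restriction> T"
  have ind: "induced_subgraph ?K (with_proj G)" using assms(2) by (intro induced_induce) simp
  interpret K: wf_digraph ?K using ind by (rule wf_digraphI_induced)
  have symK: "symmetric ?K" using induced_graph_imp_symmetric[OF sym_arcs ind] .
  interpret K: sym_digraph ?K using symK by unfold_locales
  define f where "f = (\<lambda>u. {v. u \<rightarrow>\<^sup>*\<^bsub>?K\<^esub> v})"
  have "num_components ?K = card K.sccs"
    by (simp add: num_components_def K.max_connected_iff_scc)
  also have "\<dots> = card (f ` T)"
    by (simp add: K.card_sccs_verts[symmetric] K.sccs_verts_eq f_def)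
  finally have 1: "num_components ?K = card (f ` T)" .
  have dom: "u \<rightarrow>\<^bsub>?K\<^esub> v \<longleftrightarrow> u \<in> T \<and> v \<in> T \<and> (u, v) \<in> parcs G" for u v
    by (auto simp: arcs_ends_conv)
  have 2: "f u = f v" if "u \<in> T" "v \<in> T" "(u, v) \<in> parcs G" for u v
  proof -
    have "u \<rightarrow>\<^sup>*\<^bsub>?K\<^esub> v" using dom that by (auto intro: K.reachable_adjI)
    moreover then have "v \<rightarrow>\<^sup>*\<^bsub>?K\<^esub> u" using symmetric_reachable[OF symK] by blast
    ultimately show ?thesis using K.reachable_trans by (auto simp: f_def)
  qed
  have 3: "inj_on f T" if "\<forall>u \<in> T. \<forall>v \<in> T. (u, v) \<notin> parcs G"
  proof -
    have "arcs_ends ?K = {}" using dom that by auto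
    then have "v = u" if "u \<rightarrow>\<^sup>*\<^bsub>?K\<^esub> v" for u v
      using that unfolding reachable_def by (auto elim: rtrancl_on.cases)
    moreover have "u \<rightarrow>\<^sup>*\<^bsub>?K\<^esub> u" if "u \<in> T" for u using that by (intro K.reachable_refl) simp
    ultimately have "f u = {u}" if "u \<in> T" for u using that by (auto simp: f_def)
    then show ?thesis by (auto simp: inj_on_def)
  qed
  show ?thesis using 1 2 3 by blast
qed

section \<open>The equality cases\<close>

text \<open>If no arc left \<open>X\<close>, then \<open>X\<close> would be closed under
  reachability, against strong connectedness.\<close>

lemma connected_cut_arc:
  assumes "pair_graph G" "Digraph_Component.connected (with_proj G)"
    and X: "X \<subseteq> pverts G" "X \<noteq> {}" "X \<noteq> pverts G"
  shows "\<exists>u \<in> X. \<exists>v \<in> pverts G - X. (u, v) \<in> parcs G"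
proof (rule ccontr)
  assume no: "\<not> ?thesis"
  interpret pair_graph G by fact
  have sc: "strongly_connected (with_proj G)"
    using symmetric_connected_imp_strongly_connected[OF sym_arcs assms(2)] .
  obtain u v where uv: "u \<in> X" "v \<in> pverts G" "v \<notin> X" using X by blast
  then have "(u, v) \<in> rtrancl_on (pverts G) (parcs G)"
    using sc X(1) by (auto simp: strongly_connected_def reachable_def)
  then have "v \<in> X" using uv(1)
  proof (induction rule: rtrancl_on.induct)
    case rtrancl_on_refl then show ?case by simp
  next
    case rtrancl_on_into_rtrancl_on then show ?case using no in_arcsD2 by blast
  qed
  with uv show False by simp
qed

text \<open>Some class has two elements \<open>u\<close> and \<open>v\<close>. Let \<open>A\<close>
  consist of \<open>c div 2\<close> whole classes including that one: the extra element gives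
  \<open>A\<close> more than \<open>c / 2\<close> elements, and the remaining classes supply at
  least \<open>c / 2\<close>.\<close>

lemma balanced_class_split:
  fixes f :: "'a \<Rightarrow> 'b"
  assumes fin: "finite T" and c: "card (f ` T) = c" "2 \<le> c" "c < card T"
  shows "\<exists>A \<subseteq> T. (\<forall>u \<in> A. \<forall>v \<in> T - A. f u \<noteq> f v) \<and> c < 2 * card A \<and> c \<le> 2 * card (T - A)"
proof -
  obtain u v where uv: "u \<in> T" "v \<in> T" "u \<noteq> v" "f u = f v"
    using c pigeonhole[of f T] by (auto simp: inj_on_def)
  define k where "k = c div 2"
  have k: "1 \<le> k" "k \<le> c" using c(2) by (auto simp: k_def)
  have "card (f ` T - {f u}) = c - 1" using uv(1) fin c(1) by simp
  then obtain D where D: "D \<subseteq> f ` T - {f u}" "card D = k - 1"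
    using obtain_subset_with_card_n[of "k - 1" "f ` T - {f u}"] k by (metis diff_le_mono)
  have finD: "finite D" using D(1) fin finite_subset by blast
  define E where "E = insert (f u) D"
  have E: "E \<subseteq> f ` T" "card E = k" using D uv(1) k finD by (auto simp: E_def card_insert_if)
  define A where "A = {w \<in> T. f w \<in> E}"
  have A: "A \<subseteq> T" "f ` A = E" using E by (auto simp: A_def)
  have finA: "finite A" using A(1) fin finite_subset by blast
  \<comment> \<open>Dropping \<open>u\<close> loses no class, since \<open>v\<close> still
    represents the class of \<open>u\<close>.\<close>
  have "f ` (A - {u}) = E" 
  proof -
    have "v \<in> A - {u}" using uv by (auto simp: A_def E_def)
    then have "f u \<in> f ` (A - {u})" using uv(4) by (metis image_eqI)
    then show ?thesis using A(2) by auto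
  qed
  then have "k \<le> card (A - {u})" using E(2) card_image_le[of "A - {u}" f] finA by simp
  moreover have "u \<in> A" using uv by (auto simp: A_def E_def)
  ultimately have a: "k + 1 \<le> card A" using card_Suc_Diff1[OF finA, of u] by simp
  have "f ` (T - A) = f ` T - E" by (auto simp: A_def)
  then have "card (f ` (T - A)) = c - k" using E c(1) fin by (simp add: card_Diff_subset finite_subset)
  then have b: "c - k \<le> card (T - A)" using card_image_le[of "T - A" f] fin by simp
  have "\<forall>u \<in> A. \<forall>v \<in> T - A. f u \<noteq> f v" by (auto simp: A_def)
  moreover have "c < 2 * card A" "c \<le> 2 * card (T - A)" using a b by (auto simp: k_def)
  ultimately show ?thesis using A(1) by blast
qed

text \<open>In the notation of the theorem, \<open>G = G[S] \<or> (n - |S|)K\<^sub>1\<close>.\<close>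

definition split_join :: "'a pair_pre_digraph \<Rightarrow> 'a set \<Rightarrow> bool" where
  "split_join G S \<longleftrightarrow> S \<subseteq> pverts G \<and>
    (\<forall>u \<in> S. \<forall>v \<in> pverts G - S. (u, v) \<in> parcs G) \<and>
    (\<forall>u \<in> pverts G - S. \<forall>v \<in> pverts G - S. (u, v) \<notin> parcs G)"

section \<open>Degrees, neighbourhood separators and independent sets in a connected graph\<close>

locale connected_graph =
  fixes G :: "'a pair_pre_digraph" and n \<delta> :: nat
  assumes G: "pair_graph G"
    and conn: "Digraph_Component.connected (with_proj G)"
    and n: "card (pverts G) = n"
    and \<delta>: "min_degree (with_proj G) = \<delta>"
begin

abbreviation "V \<equiv> pverts G"
abbreviation "deg \<equiv> out_degree (with_proj G)"
abbreviation "mu \<equiv> laplacian_eigenvalue (with_proj G) 1"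
abbreviation "lam \<equiv> laplacian_eigenvalue (with_proj G) (n - 1)"

lemma finV: "finite V"
proof -
  interpret pair_graph G by (rule G)
  show ?thesis by (rule pair_finite_verts)
qed

lemma neV: "V \<noteq> {}"
  using conn by (auto simp: connected_conv)

lemma no_loop: "(u, u) \<notin> parcs G"
proof -
  interpret pair_graph G by (rule G)
  show ?thesis using no_loops' by blast
qed

lemma sym: "(u, v) \<in> parcs G \<longleftrightarrow> (v, u) \<in> parcs G"
  using pair_graph_sym_iff[OF G] .

lemma deg_card: "deg u = card {v \<in> V. (u, v) \<in> parcs G}"
  using out_degree_eq_card[OF G] .

lemma delta_le_deg: "v \<in> V \<Longrightarrow> \<delta> \<le> deg v"
  using \<delta> finV by (auto simp: min_degree_def)

lemma ex_deg_delta: "\<exists>v \<in> V. deg v = \<delta>"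
  using \<delta> finV neV Min_in[of "deg ` V"] by (auto simp: min_degree_def)

lemma delta_pos:
  assumes "2 \<le> n" shows "1 \<le> \<delta>"
proof -
  obtain v where v: "v \<in> V" "deg v = \<delta>" using ex_deg_delta by blast
  have "{v} \<noteq> V"
  proof
    assume "{v} = V"
    then have "card V = card {v}" by simp
    with assms n show False by simp
  qed
  then obtain w where "w \<in> V" "(v, w) \<in> parcs G"
    using connected_cut_arc[OF G conn, of "{v}"] v(1) by auto
  then have "{v' \<in> V. (v, v') \<in> parcs G} \<noteq> {}" by blast
  then show ?thesis using v(2) finV by (auto simp: deg_card Suc_le_eq card_gt_0_iff)
qed

text \<open>The neighbourhood of \<open>v\<close> separates \<open>v\<close> from its other
  non-neighbours, of which there is at least one. In the tight case this neighbourhood is completely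
  joined to the non-neighbours.\<close>

lemma lam_le_deg:
  assumes "v \<in> V" "deg v + 2 \<le> n"
  shows "lam \<le> real (deg v)"
    and "real (deg v) \<le> lam \<Longrightarrow> u \<in> V \<Longrightarrow> (v, u) \<notin> parcs G \<Longrightarrow> (v, w) \<in> parcs G \<Longrightarrow> w \<in> V \<Longrightarrow> (u, w) \<in> parcs G"
proof -
  define T where "T = {w \<in> V. (v, w) \<in> parcs G}"
  have T: "T \<subseteq> V" "card T = deg v" "v \<notin> T" using no_loop by (auto simp: T_def deg_card)
  have "card (V - T) \<ge> 2" using assms T n finV by (simp add: card_Diff_subset finite_subset)
  then have "\<not> V - T \<subseteq> {v}" using card_mono[of "{v}" "V - T"] by auto
  then have ne: "V - T - {v} \<noteq> {}" by blast
  interpret P: graph_separation G "{v}" "V - T - {v}" T n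
    using G T n assms by (intro graph_separation.intro) (auto simp: T_def)
  show "lam \<le> real (deg v)" using P.lam_le_separator(1)[OF _ ne] T(2) by simp
  show "(u, w) \<in> parcs G" if "real (deg v) \<le> lam" "u \<in> V" "(v, u) \<notin> parcs G" "(v, w) \<in> parcs G" "w \<in> V"
    using P.lam_le_separator(2)[OF _ ne, of u w] T(2) that by (auto simp: T_def)
qed

text \<open>All degrees are at least \<open>\<delta>\<close>, and the factor \<open>card I\<close>
  cancels.\<close>

lemma independent_bound:
  assumes "I \<subseteq> V" "\<And>u v. u \<in> I \<Longrightarrow> v \<in> I \<Longrightarrow> (u, v) \<notin> parcs G" "I \<noteq> {}" "2 \<le> n"
  shows "real n * real \<delta> \<le> mu * (real n - real (card I))"
proof -
  have finI: "finite I" using assms(1) finV finite_subset by blast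
  have "(\<Sum>u \<in> I. real \<delta>) \<le> (\<Sum>u \<in> I. real (deg u))"
    using assms(1) delta_le_deg by (intro sum_mono) auto
  then have "real n * (real (card I) * real \<delta>) \<le> real n * (\<Sum>u \<in> I. real (deg u))"
    by (intro mult_left_mono) auto
  also have "\<dots> \<le> mu * (real (card I) * (real n - real (card I)))"
    using independent_degree_sum_bound[OF G n assms(4,1,2)] .
  finally have "real (card I) * (real n * real \<delta>) \<le> real (card I) * (mu * (real n - real (card I)))"
    by (simp add: mult_ac)
  moreover have "0 < card I" using finI assms(3) by (simp add: card_gt_0_iff)
  ultimately show ?thesis by simp
qed

lemma split_join_largest_ge:
  assumes "\<And>u v. u \<in> S \<Longrightarrow> v \<in> V - S \<Longrightarrow> (u, v) \<in> parcs G" "S \<subseteq> V" "S \<noteq> {}" "S \<noteq> V" "2 \<le> n"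
  shows "real n \<le> mu"
proof -
  interpret P: graph_separation G "V - S" "{}" S n
    using assms n G by (intro graph_separation.intro) auto
  have "(u, v) \<in> parcs G" if "u \<in> V - S \<union> {}" "v \<in> S" for u v
    using assms(1) sym that by blast
  then show ?thesis by (rule P.join_imp_largest_ge) (use assms in auto)
qed

end

section \<open>Vertex sets whose removal leaves at least two components\<close>

locale disconnecting_set = connected_graph +
  fixes S c
  assumes S: "S \<subseteq> V"
    and c: "num_components (with_proj G \<restriction> (V - S)) = c" "2 \<le> c"
begin

text \<open>A component labelling of \<open>V - S\<close>, fixed once so that all lemmas below refer
  to the same one.\<close>

definition cls where
  "cls = (SOME f :: 'a \<Rightarrow> 'a set. num_components (with_proj G \<restriction> (V - S)) = card (f ` (V - S)) \<and>
    (\<forall>u \<in> V - S. \<forall>v \<in> V - S. (u, v) \<in> parcs G \<longrightarrow> f u = f v) \<and>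
    ((\<forall>u \<in> V - S. \<forall>v \<in> V - S. (u, v) \<notin> parcs G) \<longrightarrow> inj_on f (V - S)))"

lemma card_cls: "card (cls ` (V - S)) = c"
  and cls_arc: "u \<in> V - S \<Longrightarrow> v \<in> V - S \<Longrightarrow> (u, v) \<in> parcs G \<Longrightarrow> cls u = cls v"
  using someI_ex[OF num_components_classes[OF G, of "V - S"], folded cls_def] c by auto

lemma finT: "finite (V - S)" using finV by simp

lemma card_T: "real (card (V - S)) = real n - real (card S)" "c \<le> card (V - S)"
proof -
  have "card (V - S) = n - card S" "card S \<le> n"
    using S finV n card_mono[of V S] by (auto simp: card_Diff_subset finite_subset)
  then show "real (card (V - S)) = real n - real (card S)" by simp
  show "c \<le> card (V - S)" using card_image_le[OF finT, of cls] card_cls by simp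
qed

lemma T_ne: "V - S \<noteq> {}"
proof
  assume "V - S = {}"
  then have "card (V - S) = 0" by (simp only: card.empty)
  with card_T(2) c(2) show False by simp
qed

lemma n2: "2 \<le> n"
  using card_T c(2) by linarith

lemma separated:
  obtains A B where "A \<noteq> {}" "B \<noteq> {}" "A \<union> B = V - S" "graph_separation G A B S n"
proof -
  have "\<exists>u \<in> V - S. \<exists>v \<in> V - S. cls u \<noteq> cls v"
  proof (rule ccontr)
    assume "\<not> ?thesis"
    moreover obtain w where "w \<in> V - S" using T_ne by blast
    ultimately have "cls ` (V - S) \<subseteq> {cls w}" by blast
    from card_mono[OF _ this] have "card (cls ` (V - S)) \<le> 1" by simp
    then show False using card_cls c(2) by simp
  qed
  then obtain u v where uv: "u \<in> V - S" "v \<in> V - S" "cls u \<noteq> cls v" by blast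
  let ?A = "{w \<in> V - S. cls w = cls u}"
  have "graph_separation G ?A (V - S - ?A) S n"
    using G S n n2 cls_arc by (intro graph_separation.intro) auto
  then show thesis using that[of ?A "V - S - ?A"] uv by blast
qed

lemma S_ne: "S \<noteq> {}"
proof
  assume "S = {}"
  obtain A B where AB: "A \<noteq> {}" "B \<noteq> {}" "A \<union> B = V - S" "graph_separation G A B S n" by (rule separated)
  interpret P: graph_separation G A B S n by (rule AB(4))
  from AB \<open>S = {}\<close> P.disj connected_cut_arc[OF G conn, of A] P.no_arcs show False by blast
qed

lemma card_S_pos: "0 < card S"
  using S_ne S finV finite_subset by (auto simp: card_gt_0_iff)

lemma lam_le: "lam \<le> real (card S)"
  and lam_eq_join: "real (card S) \<le> lam \<Longrightarrow> u \<in> S \<Longrightarrow> v \<in> V - S \<Longrightarrow> (u, v) \<in> parcs G"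
proof -
  obtain A B where AB: "A \<noteq> {}" "B \<noteq> {}" "A \<union> B = V - S" "graph_separation G A B S n" by (rule separated)
  interpret P: graph_separation G A B S n by (rule AB(4))
  show "lam \<le> real (card S)" using P.lam_le_separator(1)[OF AB(1,2)] .
  show "(u, v) \<in> parcs G" if "real (card S) \<le> lam" "u \<in> S" "v \<in> V - S"
    using P.lam_le_separator(2)[OF AB(1,2), of v u] that AB(3) pair_graph_sym_iff[OF G] by blast
qed

text \<open>Adjacent vertices of \<open>V - S\<close> share a label, so one vertex per label gives
  an independent set.\<close>

lemma representatives:
  obtains I where "I \<subseteq> V - S" "card I = c" "inj_on cls I" "\<And>u v. u \<in> I \<Longrightarrow> v \<in> I \<Longrightarrow> (u, v) \<notin> parcs G"
proof -
  obtain I where I: "I \<subseteq> V - S" "inj_on cls I" "cls ` I = cls ` (V - S)"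
    by (metis subset_image_inj subset_refl)
  have "card I = c" using I card_cls by (metis card_image)
  moreover have "(u, v) \<notin> parcs G" if "u \<in> I" "v \<in> I" for u v
  proof
    assume a: "(u, v) \<in> parcs G"
    then have "cls u = cls v" using cls_arc that I(1) by blast
    then have "u = v" using I(2) that by (auto dest: inj_onD)
    with a no_loop show False by simp
  qed
  ultimately show thesis using that I by blast
qed

lemma components_bound: "real n * real \<delta> \<le> mu * (real n - real c)"
proof -
  obtain I where I: "I \<subseteq> V - S" "card I = c" "\<And>u v. u \<in> I \<Longrightarrow> v \<in> I \<Longrightarrow> (u, v) \<notin> parcs G"
    by (rule representatives) blast
  then show ?thesis using independent_bound[of I] c(2) n2 by fastforce
qed

lemma c_less_n: "c < n"
  using card_T card_S_pos by linarith

lemma mu_pos: "0 < mu"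
proof -
  have "0 < real n * real \<delta>" using n2 delta_pos[OF n2] by simp
  then have "0 < mu * (real n - real c)" using components_bound by linarith
  then show ?thesis using c_less_n by (simp add: zero_less_mult_iff)
qed

text \<open>With \<open>X = n (mu - \<delta>)\<close>, equality reads \<open>s X = c mu lam\<close>.
  Since \<open>c mu \<le> X\<close> and \<open>lam \<le> s\<close>, both inequalities must be tight,
  and the structure of \<open>G\<close> is read off from that.\<close>

lemma equality_A:
  assumes eq: "real (card S) / real c = mu * lam / (real n * (mu - real \<delta>))"
  shows "split_join G S \<and> card S = \<delta> \<and> real \<delta> \<le> lam \<and> \<delta> + 2 \<le> n"
proof -
  define X where "X = real n * (mu - real \<delta>)"
  have cpos: "0 < real c" using c(2) by simp
  have spos: "0 < real (card S)" using card_S_pos by simp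
  have cmu: "0 < real c * mu" using cpos mu_pos by simp
  have Xge: "real c * mu \<le> X" using components_bound by (simp add: X_def algebra_simps)
  \<comment> \<open>Positivity of \<open>X\<close> makes the quotient in \<open>eq\<close> a genuine
    one, not the value 0 of a division by zero.\<close>
  then have Xpos: "0 < X" using cmu by linarith
  have eq': "real (card S) * X = real c * mu * lam"
    using eq cpos Xpos unfolding X_def[symmetric] by (simp add: field_simps)
  have "real c * mu * real (card S) \<le> X * real (card S)" using Xge spos by simp
  then have "real c * mu * real (card S) \<le> real c * mu * lam" using eq' by (simp add: mult_ac)
  then have s_le: "real (card S) \<le> lam" using cmu by (simp only: mult_le_cancel_left_pos)
  with lam_le have s_eq: "lam = real (card S)" by simp
  then have "X = real c * mu" using eq' spos by simp
  then have Xeq: "mu * (real n - real c) = real n * real \<delta>" by (simp add: X_def algebra_simps)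
  have join: "(u, v) \<in> parcs G" if "u \<in> S" "v \<in> V - S" for u v using lam_eq_join[OF s_le that] .
  have "S \<noteq> V" using card_T c by auto
  then have "real n \<le> mu" using split_join_largest_ge[OF join S S_ne] n2 by simp
  then have "real n * (real n - real c) \<le> mu * (real n - real c)"
    using c_less_n by (intro mult_right_mono) auto
  then have "real n * (real n - real c) \<le> real n * real \<delta>" using Xeq by linarith
  then have "real n - real c \<le> real \<delta>" using n2 by (simp only: mult_le_cancel_left_pos)
  then have nc: "n - c \<le> \<delta>" by linarith
  obtain I where I: "I \<subseteq> V - S" "card I = c" "inj_on cls I"
    "\<And>u v. u \<in> I \<Longrightarrow> v \<in> I \<Longrightarrow> (u, v) \<notin> parcs G" by (rule representatives) blast
  have finI: "finite I" using I(1) finT finite_subset by blast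
  have cardVI: "card (V - I) = n - c" using I finI n by (subst card_Diff_subset) auto
  \<comment> \<open>A representative has at least \<open>\<delta> \<ge> n - c\<close> neighbours,
    all in \<open>V - I\<close>, which has exactly \<open>n - c\<close> elements.\<close>
  have nbh: "{w \<in> V. (v, w) \<in> parcs G} = V - I" if "v \<in> I" for v
  proof (rule card_seteq)
    show "finite (V - I)" using finV by simp
    show "{w \<in> V. (v, w) \<in> parcs G} \<subseteq> V - I" using I(4)[OF that] by auto
    show "card (V - I) \<le> card {w \<in> V. (v, w) \<in> parcs G}"
      using cardVI nc delta_le_deg[of v] that I(1) by (auto simp: deg_card)
  qed
  obtain u v where uv: "u \<in> I" "v \<in> I" "u \<noteq> v"
    using c(2) I(2) by (metis card_le_Suc0_iff_eq finI not_less_eq_eq numeral_2_eq_2)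
  \<comment> \<open>A further vertex of \<open>V - S\<close> would be adjacent to both
    \<open>u\<close> and \<open>v\<close> and so merge their components.\<close>
  have "V - S \<subseteq> I"
  proof
    fix w assume w: "w \<in> V - S"
    show "w \<in> I"
    proof (rule ccontr)
      assume "w \<notin> I"
      then have "(u, w) \<in> parcs G" "(v, w) \<in> parcs G" using nbh uv w by blast+
      then have "cls u = cls v" using cls_arc uv I(1) w by (metis subsetD)
      then show False using uv I(3) by (auto dest: inj_onD)
    qed
  qed
  then have VI: "V - S = I" using I(1) by blast
  then have "V - I = S" using S by blast
  then have s: "card S = n - c" using cardVI by simp
  have "\<delta> \<le> deg u" using delta_le_deg uv(1) I(1) by blast
  also have "deg u = card S" using nbh[OF uv(1)] \<open>V - I = S\<close> by (simp add: deg_card)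
  finally have "card S = \<delta>" using nc s by simp
  moreover have "split_join G S" unfolding split_join_def using S join I(4) VI by auto
  ultimately show ?thesis using s_eq s c_less_n c(2) by auto
qed

text \<open>Equality reads \<open>s (mu - lam) = c lam\<close>. It first makes \<open>V - S\<close>
  independent, by a balanced split of the components, and then singles out a vertex whose
  neighbourhood is all of \<open>S\<close>.\<close>

lemma equality_B:
  assumes eq: "real (card S) / real c = lam / (mu - lam)"
  shows "split_join G S \<and> card S = \<delta> \<and> real \<delta> \<le> lam \<and> \<delta> + 2 \<le> n"
proof -
  define s where "s = real (card S)"
  have cpos: "0 < real c" using c(2) by simp
  have spos: "0 < s" using card_S_pos by (simp add: s_def)
  \<comment> \<open>A zero denominator would give the value 0, and \<open>mu > 0\<close> excludes
    that numerator and denominator are both negative.\<close>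
  have "0 < lam / (mu - lam)" using eq spos cpos by (metis divide_pos_pos s_def)
  then have lpos: "0 < lam" "0 < mu - lam" using mu_pos by (auto simp: zero_less_divide_iff)
  have eq': "s * (mu - lam) = real c * lam" using eq lpos cpos by (simp add: s_def field_simps)
  have T: "card (V - S) = c"
  proof (rule ccontr)
    assume "card (V - S) \<noteq> c"
    then have "c < card (V - S)" using card_T(2) by simp
    then obtain A where A: "A \<subseteq> V - S" "\<forall>u \<in> A. \<forall>v \<in> V - S - A. cls u \<noteq> cls v"
      "c < 2 * card A" "c \<le> 2 * card (V - S - A)"
      using balanced_class_split[OF finT card_cls c(2)] by blast
    have "(u, v) \<notin> parcs G" if "u \<in> A" "v \<in> V - S - A" for u v
      using A(1,2) cls_arc that by blast
    then interpret P: graph_separation G A "V - S - A" S n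
      using G S n n2 A(1) by (intro graph_separation.intro) auto
    define a b where "a = real (card A)" and "b = real (card (V - S - A))"
    have ab: "real c < 2 * a" "real c \<le> 2 * b" using A(3,4) unfolding a_def b_def by linarith+
    \<comment> \<open>Inserting the equality leaves \<open>4 a b \<le> c (a + b)\<close>, which
      contradicts \<open>c < 2 a\<close> and \<open>c \<le> 2 b\<close>.\<close>
    have "lam * ((a + b) * s + 4 * a * b) \<le> mu * s * (a + b)"
      using P.split_bound by (simp add: a_def b_def s_def)
    then have "lam * (4 * a * b) \<le> (s * (mu - lam)) * (a + b)" by (simp add: algebra_simps)
    then have "lam * (4 * a * b) \<le> lam * (real c * (a + b))" unfolding eq' by (simp add: mult_ac)
    then have "4 * a * b \<le> real c * (a + b)" using lpos by simp
    moreover have "real c * a \<le> 2 * b * a" using ab cpos by (intro mult_right_mono) auto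
    moreover have "real c * b < 2 * a * b" using ab cpos by (intro mult_strict_right_mono) auto
    ultimately show False by (simp add: algebra_simps)
  qed
  have inj: "inj_on cls (V - S)" using T card_cls finT by (simp add: eq_card_imp_inj_on)
  have indep: "(u, v) \<notin> parcs G" if "u \<in> V - S" "v \<in> V - S" for u v
    using cls_arc[OF that] inj_onD[OF inj _ that] no_loop by blast
  have nsc: "real n = s + real c" using card_T(1) T by (simp add: s_def)
  have smu: "s * mu = real n * lam" using eq' nsc by (simp add: algebra_simps)
  have "real n * (\<Sum>u \<in> V - S. real (deg u)) \<le> mu * (real c * s)"
    using independent_degree_sum_bound[OF G n n2, of "V - S"] indep T nsc by simp
  also have "\<dots> = real n * (real c * lam)" using smu by (simp add: mult_ac)
  \<comment> \<open>The average degree over \<open>V - S\<close> is at most \<open>lam\<close>, so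
    some vertex there has degree at most \<open>lam\<close>.\<close>
  finally have sum: "(\<Sum>u \<in> V - S. real (deg u)) \<le> (\<Sum>u \<in> V - S. lam)" using n2 T by simp
  have "\<exists>v \<in> V - S. real (deg v) \<le> lam"
  proof (rule ccontr)
    assume "\<not> ?thesis"
    then have "lam < real (deg u)" if "u \<in> V - S" for u using that by (meson not_le)
    then have "(\<Sum>u \<in> V - S. lam) < (\<Sum>u \<in> V - S. real (deg u))"
      by (rule sum_strict_mono[OF finT T_ne])
    with sum show False by simp
  qed
  then obtain v where v: "v \<in> V - S" "real (deg v) \<le> lam" by blast
  define N where "N = {w \<in> V. (v, w) \<in> parcs G}"
  have NS: "N \<subseteq> S" using indep v(1) by (auto simp: N_def)
  have finS: "finite S" using S finV finite_subset by blast
  have degv: "deg v = card N" by (simp add: deg_card N_def)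
  have "deg v \<le> card S" using NS finS by (simp add: degv card_mono)
  moreover have sn: "card S + 2 \<le> n" using nsc c(2) by (simp add: s_def)
  ultimately have dv: "deg v + 2 \<le> n" by simp
  have join: "(u, w) \<in> parcs G" if "u \<in> N" "w \<in> V - N" for u w
    using lam_le_deg(2)[OF _ dv v(2), of w u] v(1) that sym by (auto simp: N_def)
  have "N \<noteq> {}" using delta_le_deg[of v] delta_pos[OF n2] v(1) degv by auto
  moreover have "N \<subseteq> V" "N \<noteq> V" using NS S v(1) by auto
  ultimately have "real n \<le> mu" using split_join_largest_ge[OF join] n2 by blast
  \<comment> \<open>The tight separator \<open>N\<close> forces \<open>n \<le> mu\<close>; with
    \<open>s mu = n lam\<close> this gives \<open>s \<le> lam \<le> card N\<close>, while
    \<open>N\<close> is contained in \<open>S\<close>.\<close>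
  then have "s * real n \<le> real n * lam" using smu spos by (metis mult_left_mono less_imp_le)
  then have sl: "s \<le> lam" using n2 by (simp add: mult.commute)
  have lv: "lam \<le> real (deg v)" using lam_le_deg(1)[OF _ dv] v(1) by blast
  then have "card S \<le> card N" using sl degv by (simp add: s_def)
  then have NS': "N = S" using NS finS by (simp add: card_seteq)
  have leq: "lam = s" using sl lv v(2) NS' degv by (simp add: s_def)
  have "card S = \<delta>"
  proof (rule antisym)
    show "\<delta> \<le> card S" using delta_le_deg[of v] v(1) degv NS' by simp
    obtain w where w: "w \<in> V" "deg w = \<delta>" using ex_deg_delta by blast
    show "card S \<le> \<delta>"
    \<comment> \<open>The separator bound needs a non-neighbour of \<open>w\<close>. Without one,
      \<open>deg w \<ge> n - 1\<close>, which already exceeds \<open>card S\<close>.\<close>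
    proof (cases "deg w + 2 \<le> n")
      case True
      then show ?thesis using lam_le_deg(1)[OF w(1)] w(2) leq by (simp add: s_def)
    next
      case False then show ?thesis using sn w(2) by simp
    qed
  qed
  moreover have "split_join G S" using S join indep NS' by (auto simp: split_join_def)
  ultimately show ?thesis using leq sn by (simp add: s_def)
qed

end

section \<open>Toughness of split joins and the equality criteria inside \<open>G\<close>\<close>

lemma sum_sum_square_diff:
  fixes f :: "'a \<Rightarrow> real"
  shows "(\<Sum>u \<in> A. \<Sum>v \<in> B. (f u - f v)\<^sup>2)
    = real (card B) * (\<Sum>u \<in> A. (f u)\<^sup>2) + real (card A) * (\<Sum>v \<in> B. (f v)\<^sup>2)
      - 2 * (\<Sum>u \<in> A. f u) * (\<Sum>v \<in> B. f v)"
proof -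
  have "(\<Sum>u \<in> A. \<Sum>v \<in> B. (f u - f v)\<^sup>2)
    = (\<Sum>u \<in> A. \<Sum>v \<in> B. (f u)\<^sup>2) + (\<Sum>u \<in> A. \<Sum>v \<in> B. (f v)\<^sup>2) - (\<Sum>u \<in> A. \<Sum>v \<in> B. 2 * f u * f v)"
    by (simp add: power2_diff sum.distrib sum_subtractf)
  also have "(\<Sum>u \<in> A. \<Sum>v \<in> B. 2 * f u * f v) = 2 * (\<Sum>u \<in> A. f u) * (\<Sum>v \<in> B. f v)"
    by (simp add: sum_product sum_distrib_left[of 2, symmetric] mult.assoc)
  finally show ?thesis by (simp add: sum_distrib_left)
qed

text \<open>Dropping the adjacency indicator compares \<open>G\<close> with the complete graph,
  whose form is \<open>n\<close> times the squared norm minus the square of the sum.\<close>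

lemma dirichlet_le_card:
  "dirichlet G x \<le> real (card (pverts G)) * (\<Sum>v \<in> pverts G. (x v)\<^sup>2)"
proof -
  have "2 * dirichlet G x \<le> (\<Sum>u \<in> pverts G. \<Sum>v \<in> pverts G. (x u - x v)\<^sup>2)"
    unfolding dirichlet_def by (simp, intro sum_mono) auto
  also have "\<dots> = 2 * (real (card (pverts G)) * (\<Sum>v \<in> pverts G. (x v)\<^sup>2)) - 2 * (\<Sum>v \<in> pverts G. x v)\<^sup>2"
    unfolding sum_sum_square_diff by (simp add: power2_eq_square)
  finally show ?thesis using zero_le_power2[of "\<Sum>v \<in> pverts G. x v"] by linarith
qed

lemma num_components_independent:
  assumes "pair_graph G" "T \<subseteq> pverts G" "\<And>u v. u \<in> T \<Longrightarrow> v \<in> T \<Longrightarrow> (u, v) \<notin> parcs G"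
  shows "num_components (with_proj G \<restriction> T) = card T"
  using num_components_classes[OF assms(1,2)] assms(3) by (auto simp: card_image)

context connected_graph
begin

lemma disconnecting_setI:
  assumes "S \<subseteq> V" "2 \<le> num_components (with_proj G \<restriction> (V - S))"
  shows "disconnecting_set G n \<delta> S (num_components (with_proj G \<restriction> (V - S)))"
  using assms connected_graph_axioms
  by (intro disconnecting_set.intro disconnecting_set_axioms.intro) auto

text \<open>A real value means that \<open>G\<close> is not complete. Deleting all but two
  non-adjacent vertices leaves two components, so \<open>Min\<close> is taken over a nonempty finite
  set and is attained.\<close>

lemma toughness_attained:
  assumes "toughness (with_proj G) = ereal r"
  shows "\<exists>S c. disconnecting_set G n \<delta> S c \<and> real (card S) / real c = r"
proof -
  let ?N = "\<lambda>S. num_components (with_proj G \<restriction> (V - S))"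
  let ?R = "{real (card S) / real (?N S) | S. S \<subseteq> V \<and> ?N S \<ge> 2}"
  have nc: "\<not> complete_digraph (card V) (with_proj G)"
    using assms by (auto simp: toughness_def)
  interpret pair_graph G by (rule G)
  from nc obtain u v where uv: "u \<in> V" "v \<in> V" "u \<noteq> v" "(u, v) \<notin> parcs G"
    unfolding complete_digraph_pair_def using finV no_loop in_arcsD1 in_arcsD2 by auto
  have "V - (V - {u, v}) = {u, v}" using uv by auto
  moreover have "num_components (with_proj G \<restriction> {u, v}) = card {u, v}"
    using uv no_loop sym by (intro num_components_independent[OF G]) auto
  ultimately have "?N (V - {u, v}) = 2" using uv(3) by simp
  then have "?R \<noteq> {}" by (auto intro!: exI[of _ "V - {u, v}"])
  moreover have "?R \<subseteq> (\<lambda>S. real (card S) / real (?N S)) ` Pow V" by auto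
  then have "finite ?R" using finV by (meson finite_Pow_iff finite_imageI finite_subset)
  ultimately have "Min ?R \<in> ?R" by (rule Min_in[rotated])
  moreover have "r = Min ?R" using assms nc by (simp add: toughness_def)
  ultimately obtain S where "S \<subseteq> V" "?N S \<ge> 2" "r = real (card S) / real (?N S)" by auto
  then show ?thesis using disconnecting_setI by blast
qed

text \<open>The set \<open>S\<close> itself leaves \<open>n - \<delta>\<close> components. Any other
  admissible set has at least \<open>lam = \<delta>\<close> elements, and
  \<open>components_bound\<close> with \<open>mu = n\<close> allows it at most
  \<open>n - \<delta>\<close> components.\<close>

lemma split_join_toughness:
  assumes sj: "split_join G S" and S: "card S = \<delta>" and lam: "real \<delta> \<le> lam" and d: "1 \<le> \<delta>" "\<delta> + 2 \<le> n"
  shows "mu = real n" "lam = real \<delta>" "toughness (with_proj G) = ereal (real \<delta> / (real n - real \<delta>))"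
proof -
  let ?N = "\<lambda>S. num_components (with_proj G \<restriction> (V - S))"
  let ?R = "{real (card S) / real (?N S) | S. S \<subseteq> V \<and> ?N S \<ge> 2}"
  have SV: "S \<subseteq> V" and join: "\<And>u v. u \<in> S \<Longrightarrow> v \<in> V - S \<Longrightarrow> (u, v) \<in> parcs G"
    and indep: "\<And>u v. u \<in> V - S \<Longrightarrow> v \<in> V - S \<Longrightarrow> (u, v) \<notin> parcs G"
    using sj by (auto simp: split_join_def)
  have cT: "card (V - S) = n - \<delta>" using SV S n finV by (simp add: card_Diff_subset finite_subset)
  have N: "?N S = n - \<delta>" using num_components_independent[OF G, of "V - S"] indep cT by simp
  interpret D: disconnecting_set G n \<delta> S "n - \<delta>"
    using disconnecting_setI[OF SV] N d by simp
  show mu: "mu = real n"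
  proof (rule antisym)
    show "mu \<le> real n" using largest_le[OF G neV] dirichlet_le_card[of G] n by blast
    have "S \<noteq> V" using S n d by auto
    then show "real n \<le> mu" using split_join_largest_ge[OF join SV D.S_ne] D.n2 by blast
  qed
  show lam_eq: "lam = real \<delta>" using lam D.lam_le S by simp
  have nc: "\<not> complete_digraph (card V) (with_proj G)"
  proof
    assume "complete_digraph (card V) (with_proj G)"
    then have "V - S \<subseteq> {u}" if "u \<in> V - S" for u
      using indep that by (auto simp: complete_digraph_pair_def)
    then have "card (V - S) \<le> 1" using D.T_ne card_mono[of "{_}" "V - S"] by fastforce
    with cT d show False by simp
  qed
  have "Min ?R = real \<delta> / (real n - real \<delta>)"
  proof (rule Min_eqI)
    have "?R \<subseteq> (\<lambda>S. real (card S) / real (?N S)) ` Pow V" by auto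
    then show "finite ?R" using finV by (meson finite_Pow_iff finite_imageI finite_subset)
    show "real \<delta> / (real n - real \<delta>) \<in> ?R"
      using N SV S d by (auto intro!: exI[of _ S] simp: of_nat_diff)
    fix y assume "y \<in> ?R"
    then obtain S' where S': "S' \<subseteq> V" "?N S' \<ge> 2" and y: "y = real (card S') / real (?N S')" by auto
    interpret E: disconnecting_set G n \<delta> S' "?N S'" using disconnecting_setI[OF S'] .
    have "real n * real \<delta> \<le> real n * (real n - real (?N S'))" using E.components_bound mu by simp
    then have "real \<delta> \<le> real n - real (?N S')" using E.n2 by (simp only: mult_le_cancel_left_pos)
    then have "real (?N S') \<le> real n - real \<delta>" by simp
    moreover have "real \<delta> \<le> real (card S')" using E.lam_le lam_eq by simp
    ultimately show "real \<delta> / (real n - real \<delta>) \<le> y"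
      unfolding y using S'(2) by (intro frac_le) auto
  qed
  then show "toughness (with_proj G) = ereal (real \<delta> / (real n - real \<delta>))"
    using nc by (simp add: toughness_def)
qed

lemma toughness_eq_A_iff:
  "toughness (with_proj G) = ereal (mu * lam / (real n * (mu - real \<delta>))) \<longleftrightarrow>
    1 \<le> \<delta> \<and> \<delta> + 2 \<le> n \<and> (\<exists>S. split_join G S \<and> card S = \<delta> \<and> real \<delta> \<le> lam)"
  (is "?L \<longleftrightarrow> ?R")
proof
  assume ?L
  then obtain S c where "disconnecting_set G n \<delta> S c"
    and eq: "real (card S) / real c = mu * lam / (real n * (mu - real \<delta>))"
    using toughness_attained by blast
  then interpret D: disconnecting_set G n \<delta> S c by simp
  show ?R using D.equality_A[OF eq] delta_pos[OF D.n2] by blast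
next
  assume ?R
  \<comment> \<open>With \<open>mu = n\<close> and \<open>lam = \<delta>\<close> the right-hand side
    reduces to \<open>\<delta> / (n - \<delta>)\<close>.\<close>
  then show ?L using split_join_toughness by fastforce
qed

lemma toughness_eq_B_iff:
  "toughness (with_proj G) = ereal (lam / (mu - lam)) \<longleftrightarrow>
    1 \<le> \<delta> \<and> \<delta> + 2 \<le> n \<and> (\<exists>S. split_join G S \<and> card S = \<delta> \<and> real \<delta> \<le> lam)"
  (is "?L \<longleftrightarrow> ?R")
proof
  assume ?L
  then obtain S c where "disconnecting_set G n \<delta> S c"
    and eq: "real (card S) / real c = lam / (mu - lam)"
    using toughness_attained by blast
  then interpret D: disconnecting_set G n \<delta> S c by simp
  show ?R using D.equality_B[OF eq] delta_pos[OF D.n2] by blast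
next
  assume ?R
  then show ?L using split_join_toughness by fastforce
qed

end

section \<open>Joins with edgeless graphs\<close>

text \<open>Ordered pairs split into four blocks: pairs inside \<open>S\<close> give the form of
  \<open>H\<close>, the two mixed blocks are complete and equal, and pairs outside \<open>S\<close>
  contribute nothing.\<close>

lemma split_join_dirichlet:
  assumes G: "pair_graph G" and sj: "split_join G S"
    and bij: "bij_betw \<psi> (pverts H) S"
    and adj: "\<And>h k. h \<in> pverts H \<Longrightarrow> k \<in> pverts H \<Longrightarrow> (h, k) \<in> parcs H \<longleftrightarrow> (\<psi> h, \<psi> k) \<in> parcs G"
  shows "dirichlet G x = dirichlet H (\<lambda>h. x (\<psi> h)) + (\<Sum>u \<in> S. \<Sum>v \<in> pverts G - S. (x u - x v)\<^sup>2)"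
proof -
  interpret pair_graph G by fact
  let ?I = "pverts G - S"
  let ?t = "\<lambda>u v. of_bool ((u, v) \<in> parcs G) * (x u - x v)\<^sup>2"
  have S: "S \<subseteq> pverts G" using sj by (simp add: split_join_def)
  have split: "(\<Sum>v \<in> pverts G. f v) = (\<Sum>v \<in> S. f v) + (\<Sum>v \<in> ?I. f v)" for f :: "'a \<Rightarrow> real"
    using S pair_finite_verts by (simp add: sum.subset_diff)
  have SI: "(\<Sum>u \<in> S. \<Sum>v \<in> ?I. ?t u v) = (\<Sum>u \<in> S. \<Sum>v \<in> ?I. (x u - x v)\<^sup>2)"
    using sj by (intro sum.cong) (auto simp: split_join_def)
  have "(\<Sum>u \<in> ?I. \<Sum>v \<in> S. ?t u v) = (\<Sum>u \<in> S. \<Sum>v \<in> ?I. ?t v u)" by (rule sum.swap)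
  also have "\<dots> = (\<Sum>u \<in> S. \<Sum>v \<in> ?I. ?t u v)"
    using pair_graph_sym_iff[OF G] by (simp add: power2_commute)
  finally have IS: "(\<Sum>u \<in> ?I. \<Sum>v \<in> S. ?t u v) = (\<Sum>u \<in> S. \<Sum>v \<in> ?I. (x u - x v)\<^sup>2)" using SI by simp
  have II: "(\<Sum>u \<in> ?I. \<Sum>v \<in> ?I. ?t u v) = 0"
    using sj by (intro sum.neutral ballI) (auto simp: split_join_def)
  have "(\<Sum>u \<in> S. \<Sum>v \<in> S. ?t u v) = (\<Sum>h \<in> pverts H. \<Sum>k \<in> pverts H. ?t (\<psi> h) (\<psi> k))"
    by (simp only: sum.reindex_bij_betw[OF bij, symmetric])
  also have "\<dots> = 2 * dirichlet H (\<lambda>h. x (\<psi> h))"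
    by (simp add: dirichlet_def adj)
  finally have SS: "(\<Sum>u \<in> S. \<Sum>v \<in> S. ?t u v) = 2 * dirichlet H (\<lambda>h. x (\<psi> h))" .
  have "2 * dirichlet G x = (\<Sum>u \<in> S. \<Sum>v \<in> S. ?t u v) + (\<Sum>u \<in> S. \<Sum>v \<in> ?I. ?t u v)
      + ((\<Sum>u \<in> ?I. \<Sum>v \<in> S. ?t u v) + (\<Sum>u \<in> ?I. \<Sum>v \<in> ?I. ?t u v))"
    unfolding dirichlet_def split sum.distrib by simp
  then show ?thesis unfolding SS IS II SI by simp
qed

text \<open>Extending a mean-zero vector of \<open>H\<close> by 0 adds \<open>n - d\<close> to its
  Rayleigh quotient, which gives one direction. For the other, the restriction to \<open>S\<close>
  is centred and the remaining terms are collected. The guard \<open>2 \<le> d\<close> is there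
  because index 0 is meaningless.\<close>

lemma split_join_second_smallest_iff:
  assumes G: "pair_graph G" and H: "pair_graph H" and sj: "split_join G S"
    and bij: "bij_betw \<psi> (pverts H) S"
    and adj: "\<And>h k. h \<in> pverts H \<Longrightarrow> k \<in> pverts H \<Longrightarrow> (h, k) \<in> parcs H \<longleftrightarrow> (\<psi> h, \<psi> k) \<in> parcs G"
    and n: "card (pverts G) = n" and S: "card S = d" and d: "1 \<le> d" "d + 2 \<le> n"
  shows "real d \<le> laplacian_eigenvalue (with_proj G) (n - 1) \<longleftrightarrow>
    (2 \<le> d \<longrightarrow> 2 * real d - real n \<le> laplacian_eigenvalue (with_proj H) (d - 1))"
    (is "?L \<longleftrightarrow> ?R")
proof -
  interpret pair_graph G by fact
  let ?V = "pverts G" and ?I = "pverts G - S"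
  have SV: "S \<subseteq> ?V" using sj by (simp add: split_join_def)
  have n2: "2 \<le> n" using d by simp
  have cI: "real (card ?I) = real n - real d"
    using SV S n d pair_finite_verts by (simp add: card_Diff_subset finite_subset of_nat_diff)
  have cH: "card (pverts H) = d" using bij S bij_betw_same_card by blast
  have split: "(\<Sum>v \<in> ?V. f v) = (\<Sum>v \<in> S. f v) + (\<Sum>v \<in> ?I. f v)" for f :: "'a \<Rightarrow> real"
    using SV pair_finite_verts by (simp add: sum.subset_diff)
  have reindex: "(\<Sum>v \<in> S. f v) = (\<Sum>h \<in> pverts H. f (\<psi> h))" for f :: "'a \<Rightarrow> real"
    using sum.reindex_bij_betw[OF bij, of f] by simp
  have dir: "dirichlet G x = dirichlet H (\<lambda>h. x (\<psi> h)) + ((real n - real d) * (\<Sum>v \<in> S. (x v)\<^sup>2)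
      + real d * (\<Sum>v \<in> ?I. (x v)\<^sup>2) - 2 * (\<Sum>v \<in> S. x v) * (\<Sum>v \<in> ?I. x v))" for x
    using split_join_dirichlet[OF G sj bij adj, of x] by (simp add: sum_sum_square_diff cI S)
  show ?thesis
  proof
    assume ?L
    show ?R
    proof (intro impI le_second_smallest[OF H cH])
      fix y :: "'b \<Rightarrow> real" assume y: "(\<Sum>h \<in> pverts H. y h) = 0"
      define x where "x = (\<lambda>v. if v \<in> S then y (the_inv_into (pverts H) \<psi> v) else 0)"
      have x\<psi>: "x (\<psi> h) = y h" if "h \<in> pverts H" for h
        using that bij by (auto simp: x_def bij_betw_def the_inv_into_f_f)
      have "(\<Sum>v \<in> ?I. x v) = 0" "(\<Sum>v \<in> ?I. (x v)\<^sup>2) = 0" by (auto simp: x_def intro!: sum.neutral)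
      moreover have "(\<Sum>v \<in> S. x v) = 0" "(\<Sum>v \<in> S. (x v)\<^sup>2) = (\<Sum>h \<in> pverts H. (y h)\<^sup>2)"
        unfolding reindex using y by (simp_all add: x\<psi>)
      moreover have "dirichlet H (\<lambda>h. x (\<psi> h)) = dirichlet H y" by (simp add: dirichlet_def x\<psi>)
      ultimately have "laplacian_eigenvalue (with_proj G) (n - 1) * (\<Sum>h \<in> pverts H. (y h)\<^sup>2)
          \<le> dirichlet H y + (real n - real d) * (\<Sum>h \<in> pverts H. (y h)\<^sup>2)"
        using second_smallest_le_dirichlet[OF G n n2, of x] by (simp add: dir split)
      moreover have "real d * (\<Sum>h \<in> pverts H. (y h)\<^sup>2)
          \<le> laplacian_eigenvalue (with_proj G) (n - 1) * (\<Sum>h \<in> pverts H. (y h)\<^sup>2)"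
        using \<open>?L\<close> by (intro mult_right_mono sum_nonneg) auto
      ultimately show "(2 * real d - real n) * (\<Sum>h \<in> pverts H. (y h)\<^sup>2) \<le> dirichlet H y"
        by (simp add: algebra_simps)
    qed
  next
    assume R: ?R
    show ?L
    proof (rule le_second_smallest[OF G n n2])
      fix x :: "'a \<Rightarrow> real" assume x: "(\<Sum>v \<in> ?V. x v) = 0"
      define t where "t = (\<Sum>v \<in> S. x v) / real d"
      have h: "(\<Sum>v \<in> S. x v) = real d * t" using d by (simp add: t_def)
      have hI: "(\<Sum>v \<in> ?I. x v) = - (real d * t)" using x h split[of x] by simp
      define y where "y = (\<lambda>h. x (\<psi> h) - t)"
      have y0: "(\<Sum>h \<in> pverts H. y h) = 0"
        using h unfolding reindex by (simp add: y_def sum_subtractf cH)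
      have "(\<Sum>h \<in> pverts H. (y h)\<^sup>2) = (\<Sum>v \<in> S. (x v - t)\<^sup>2)" unfolding reindex y_def ..
      also have "\<dots> = (\<Sum>v \<in> S. (x v)\<^sup>2 - 2 * t * x v + t\<^sup>2)"
        by (intro sum.cong) (auto simp: power2_diff)
      also have "\<dots> = (\<Sum>v \<in> S. (x v)\<^sup>2) - 2 * t * (\<Sum>v \<in> S. x v) + real d * t\<^sup>2"
        by (simp add: sum.distrib sum_subtractf sum_distrib_left S)
      finally have y2: "(\<Sum>h \<in> pverts H. (y h)\<^sup>2) = (\<Sum>v \<in> S. (x v)\<^sup>2) - real d * t\<^sup>2"
        by (simp add: h power2_eq_square)
      have dH: "dirichlet H (\<lambda>h. x (\<psi> h)) = dirichlet H y" by (simp add: dirichlet_def y_def)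
      have "(2 * real d - real n) * (\<Sum>h \<in> pverts H. (y h)\<^sup>2) \<le> dirichlet H y"
      proof (cases "2 \<le> d")
        case True
        then have "(2 * real d - real n) * (\<Sum>h \<in> pverts H. (y h)\<^sup>2)
          \<le> laplacian_eigenvalue (with_proj H) (d - 1) * (\<Sum>h \<in> pverts H. (y h)\<^sup>2)"
          using R by (intro mult_right_mono sum_nonneg) auto
        then show ?thesis using second_smallest_le_dirichlet[OF H cH True y0] by linarith
      next
        \<comment> \<open>Here \<open>d = 1\<close>, so \<open>2 d - n\<close> is negative and
          nonnegativity of the form suffices.\<close>
        case False
        then have "2 * real d - real n \<le> 0" using d by simp
        then have "(2 * real d - real n) * (\<Sum>h \<in> pverts H. (y h)\<^sup>2) \<le> 0"
          by (intro mult_nonpos_nonneg sum_nonneg) auto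
        then show ?thesis using dirichlet_nonneg[of H y] by linarith
      qed
      \<comment> \<open>After the bound for \<open>y\<close> is inserted, this is exactly the
        surplus of the energy of \<open>x\<close> over \<open>d\<close> times its squared
        norm.\<close>
      moreover have "0 \<le> real n * (real d * t\<^sup>2)" by simp
      ultimately show "real d * (\<Sum>v \<in> ?V. (x v)\<^sup>2) \<le> dirichlet G x"
        unfolding dir dH y2 h hI split by (simp add: algebra_simps power2_eq_square)
    qed
  qed
qed

section \<open>Isomorphisms onto a join with an edgeless graph\<close>

lemma digraph_iso_pair_iff:
  assumes "pair_wf_digraph G"
  shows "digraph_iso (with_proj G) (with_proj K) \<longleftrightarrow>
    (\<exists>\<phi>. inj_on \<phi> (pverts G) \<and> pverts K = \<phi> ` pverts G \<and> parcs K = map_prod \<phi> \<phi> ` parcs G)"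
    (is "?L \<longleftrightarrow> ?R")
proof -
  interpret pair_wf_digraph G by fact
  show ?thesis
  proof
    assume ?L
    then obtain f where f: "digraph_isomorphism f" "with_proj K = app_iso f (with_proj G)"
      by (auto simp: digraph_iso_def)
    let ?\<phi> = "iso_verts f"
    have inj: "inj_on ?\<phi> (pverts G)" using f(1) by (simp add: digraph_isomorphism_def)
    have V: "pverts K = ?\<phi> ` pverts G"
      using arg_cong[OF f(2), of verts] by simp
    \<comment> \<open>Tail and head in the image are the projections, so the arc map is determined
      by the vertex map.\<close>
    have tl: "iso_tail f = fst" "iso_head f = snd"
      using arg_cong[OF f(2), of tail] arg_cong[OF f(2), of head] by simp_all
    have "iso_arcs f e = map_prod ?\<phi> ?\<phi> e" if "e \<in> parcs G" for e
      using f(1) that by (cases e, cases "iso_arcs f e") (auto simp: digraph_isomorphism_def tl)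
    then have "parcs K = map_prod ?\<phi> ?\<phi> ` parcs G"
      using arg_cong[OF f(2), of arcs] by simp
    with inj V show ?R by blast
  next
    assume ?R
    then obtain \<phi> where \<phi>: "inj_on \<phi> (pverts G)" "pverts K = \<phi> ` pverts G"
      "parcs K = map_prod \<phi> \<phi> ` parcs G" by blast
    let ?f = "\<lparr> iso_verts = \<phi>, iso_arcs = map_prod \<phi> \<phi>, iso_head = snd, iso_tail = fst \<rparr>"
    have "inj_on (map_prod \<phi> \<phi>) (parcs G)"
      using \<phi>(1) in_arcsD1 in_arcsD2 by (auto simp: inj_on_def)
    then have "digraph_isomorphism ?f"
      using \<phi>(1) wf_digraph_axioms by (simp add: digraph_isomorphism_def)
    moreover have "with_proj K = app_iso ?f (with_proj G)"
      using \<phi> by (simp add: app_iso_def with_proj_def)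
    ultimately show ?L unfolding digraph_iso_def by blast
  qed
qed

text \<open>The set \<open>S\<close> is the preimage of the left summand, and \<open>\<psi>\<close>
  is the inverse isomorphism after \<open>Inl\<close>.\<close>

lemma join_edgeless_iso_imp_split_join:
  fixes H :: "'b pair_pre_digraph"
  assumes G: "pair_graph G" and H: "pair_graph H"
    and iso: "digraph_iso (with_proj G) (with_proj (graph_join H (edgeless_graph m)))"
  shows "\<exists>S \<psi>. split_join G S \<and> bij_betw \<psi> (pverts H) S \<and>
    (\<forall>h \<in> pverts H. \<forall>k \<in> pverts H. (h, k) \<in> parcs H \<longleftrightarrow> (\<psi> h, \<psi> k) \<in> parcs G)"
proof -
  interpret pair_graph G by (rule G)
  interpret H: pair_graph H by (rule H)
  let ?K = "graph_join H (edgeless_graph m)"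
  obtain \<phi> where inj: "inj_on \<phi> (pverts G)" and V: "pverts ?K = \<phi> ` pverts G"
    and E: "parcs ?K = map_prod \<phi> \<phi> ` parcs G"
    using iso digraph_iso_pair_iff[of G ?K] pair_wf_digraph_axioms by blast
  have arc: "(u, v) \<in> parcs G \<longleftrightarrow> (\<phi> u, \<phi> v) \<in> parcs ?K" if "u \<in> pverts G" "v \<in> pverts G" for u v
  proof
    assume "(\<phi> u, \<phi> v) \<in> parcs ?K"
    then obtain u' v' where *: "(u', v') \<in> parcs G" "\<phi> u' = \<phi> u" "\<phi> v' = \<phi> v" unfolding E by auto
    then have "u' = u" "v' = v" using inj that in_arcsD1 in_arcsD2 by (auto dest: inj_onD)
    with * show "(u, v) \<in> parcs G" by simp
  qed (auto simp: E)
  define \<psi> where "\<psi> = (\<lambda>h. the_inv_into (pverts G) \<phi> (Inl h))"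
  have Inl: "Inl h \<in> \<phi> ` pverts G" if "h \<in> pverts H" for h
    using that unfolding V[symmetric] by (simp add: graph_join_def)
  have \<psi>: "\<psi> h \<in> pverts G" "\<phi> (\<psi> h) = Inl h" if "h \<in> pverts H" for h
    using the_inv_into_into[OF inj Inl[OF that] subset_refl] f_the_inv_into_f[OF inj Inl[OF that]]
    by (auto simp: \<psi>_def)
  define S where "S = \<psi> ` pverts H"
  have "inj_on \<psi> (pverts H)" using \<psi>(2) by (metis inj_onI sum.inject(1))
  then have "bij_betw \<psi> (pverts H) S" by (simp add: bij_betw_def S_def)
  moreover have "(h, k) \<in> parcs H \<longleftrightarrow> (\<psi> h, \<psi> k) \<in> parcs G" if "h \<in> pverts H" "k \<in> pverts H" for h k
    using that \<psi> arc by (auto simp: graph_join_def)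
  moreover have Inr: "\<exists>i. \<phi> v = Inr i \<and> i \<in> pverts (edgeless_graph m)" if v: "v \<in> pverts G - S" for v
  proof -
    have "\<phi> v \<in> pverts ?K" using V v by blast
    moreover have "\<phi> v \<noteq> Inl h" if "h \<in> pverts H" for h
      using \<psi>[OF that] inj v that by (metis DiffD1 DiffD2 S_def image_eqI inj_onD)
    ultimately show ?thesis by (auto simp: graph_join_def)
  qed
  have "split_join G S"
    unfolding split_join_def
  proof (intro conjI ballI)
    show "S \<subseteq> pverts G" using \<psi> by (auto simp: S_def)
    show "(u, v) \<in> parcs G" if "u \<in> S" "v \<in> pverts G - S" for u v
      using that Inr[OF that(2)] \<psi> arc[of u v] by (auto simp: S_def graph_join_def)
    show "(u, v) \<notin> parcs G" if "u \<in> pverts G - S" "v \<in> pverts G - S" for u v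
      using that Inr[OF that(1)] Inr[OF that(2)] arc[of u v] by (auto simp: graph_join_def edgeless_graph_def)
  qed
  ultimately show ?thesis by blast
qed

text \<open>The graph \<open>H\<close> is the induced subgraph on \<open>S\<close>, renumbered by
  natural numbers; the vertices outside \<open>S\<close> are numbered separately to match
  \<open>edgeless_graph\<close>.\<close>

lemma split_join_imp_join_edgeless_iso:
  assumes G: "pair_graph G" and sj: "split_join G S"
  shows "\<exists>(H :: nat pair_pre_digraph) \<psi>. pair_graph H \<and> bij_betw \<psi> (pverts H) S \<and>
    (\<forall>h \<in> pverts H. \<forall>k \<in> pverts H. (h, k) \<in> parcs H \<longleftrightarrow> (\<psi> h, \<psi> k) \<in> parcs G) \<and>
    digraph_iso (with_proj G) (with_proj (graph_join H (edgeless_graph (card (pverts G - S)))))"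
proof -
  interpret pair_graph G by (rule G)
  let ?I = "pverts G - S" and ?E = "parcs G \<inter> S \<times> S"
  have SV: "S \<subseteq> pverts G" using sj by (simp add: split_join_def)
  have fin: "finite S" "finite ?I" using finite_subset[OF SV pair_finite_verts] pair_finite_verts by auto
  obtain g where g: "bij_betw g S {0..<card S}" using ex_bij_betw_finite_nat[OF fin(1)] by blast
  obtain g' where g': "bij_betw g' ?I {0..<card ?I}" using ex_bij_betw_finite_nat[OF fin(2)] by blast
  have injg: "inj_on g S" "g ` S = {0..<card S}" using g by (auto simp: bij_betw_def)
  have injg': "inj_on g' ?I" "g' ` ?I = {..<card ?I}" using g' by (auto simp: bij_betw_def)
  define H where "H = \<lparr> pverts = {0..<card S}, parcs = map_prod g g ` ?E \<rparr>"
  have H: "pair_graph H"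
  proof
    show "finite (pverts H)" "finite (parcs H)" using pair_finite_arcs by (auto simp: H_def)
    show "symmetric (with_proj H)"
      using arcs_symmetric by (force simp: symmetric_def H_def sym_def)
    fix e assume "e \<in> parcs H"
    then obtain u v where uv: "e = (g u, g v)" "(u, v) \<in> parcs G" "u \<in> S" "v \<in> S" by (auto simp: H_def)
    then show "fst e \<in> pverts H" "snd e \<in> pverts H" using injg(2) by (auto simp: H_def)
    have "u \<noteq> v" using uv(2) no_loops' by blast
    then show "fst e \<noteq> snd e" using uv injg(1) by (auto dest: inj_onD)
  qed
  define \<psi> where "\<psi> = the_inv_into S g"
  have \<psi>: "bij_betw \<psi> (pverts H) S" unfolding \<psi>_def H_def using bij_betw_the_inv_into[OF g] by simp
  have "(h, k) \<in> parcs H \<longleftrightarrow> (\<psi> h, \<psi> k) \<in> parcs G" if "h \<in> pverts H" "k \<in> pverts H" for h k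
  proof -
    have "h \<in> g ` S" "k \<in> g ` S" using that injg(2) by (auto simp: H_def)
    then obtain u v where uv: "u \<in> S" "v \<in> S" "h = g u" "k = g v" by blast
    have "(g u, g v) \<in> map_prod g g ` ?E \<longleftrightarrow> (u, v) \<in> parcs G"
      using uv injg(1) by (auto dest: inj_onD)
    then show ?thesis using uv injg(1) by (simp add: H_def \<psi>_def the_inv_into_f_f)
  qed
  moreover have "digraph_iso (with_proj G) (with_proj (graph_join H (edgeless_graph (card ?I))))"
  proof -
    define \<phi> where "\<phi> = (\<lambda>v. if v \<in> S then Inl (g v) else Inr (g' v))"
    have inj: "inj_on \<phi> (pverts G)"
      using injg(1) injg'(1) by (auto simp: inj_on_def \<phi>_def)
    have \<phi>S: "\<phi> ` S = Inl ` {0..<card S}" unfolding injg(2)[symmetric] by (auto simp: \<phi>_def)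
    have \<phi>I: "\<phi> ` ?I = Inr ` {..<card ?I}" unfolding injg'(2)[symmetric] by (force simp: \<phi>_def)
    have "pverts G = S \<union> ?I" using SV by blast
    then have V: "pverts (graph_join H (edgeless_graph (card ?I))) = \<phi> ` pverts G"
      using \<phi>S \<phi>I by (metis (no_types) H_def edgeless_graph_def graph_join_def image_Un pair_pre_digraph.select_convs(1))
    \<comment> \<open>These blocks correspond to the arc sets in \<open>graph_join\<close>; the
      edgeless factor adds none.\<close>
    have "parcs G = ?E \<union> S \<times> ?I \<union> ?I \<times> S"
    proof (intro subset_antisym subsetI)
      fix e assume e: "e \<in> parcs G"
      obtain u v where uv: "e = (u, v)" by (cases e)
      then have "u \<in> pverts G" "v \<in> pverts G" using e in_arcsD1 in_arcsD2 by auto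
      then show "e \<in> ?E \<union> S \<times> ?I \<union> ?I \<times> S" using e uv sj by (auto simp: split_join_def)
    next
      fix e assume "e \<in> ?E \<union> S \<times> ?I \<union> ?I \<times> S"
      then show "e \<in> parcs G" using sj arcs_symmetric by (auto simp: split_join_def)
    qed
    then have "map_prod \<phi> \<phi> ` parcs G
      = map_prod \<phi> \<phi> ` ?E \<union> map_prod \<phi> \<phi> ` (S \<times> ?I) \<union> map_prod \<phi> \<phi> ` (?I \<times> S)"
      by (metis (no_types) image_Un)
    also have "map_prod \<phi> \<phi> ` (S \<times> ?I) = \<phi> ` S \<times> \<phi> ` ?I" by (rule map_prod_surj_on[OF refl refl])
    also have "map_prod \<phi> \<phi> ` (?I \<times> S) = \<phi> ` ?I \<times> \<phi> ` S" by (rule map_prod_surj_on[OF refl refl])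
    also have "map_prod \<phi> \<phi> ` ?E = map_prod Inl Inl ` map_prod g g ` ?E"
      unfolding image_image by (intro image_cong) (auto simp: \<phi>_def)
    finally have "parcs (graph_join H (edgeless_graph (card ?I))) = map_prod \<phi> \<phi> ` parcs G"
      unfolding \<phi>S \<phi>I by (simp add: graph_join_def H_def edgeless_graph_def)
    then show ?thesis using inj V digraph_iso_pair_iff[OF pair_wf_digraph_axioms] by blast
  qed
  ultimately show ?thesis using H \<psi> by blast
qed

lemma ex_join_edgeless_iso_iff:
  assumes G: "pair_graph G" and n: "card (pverts G) = n" and d: "1 \<le> d" "d + 2 \<le> n"
  shows "(\<exists>H :: nat pair_pre_digraph. pair_graph H \<and> card (pverts H) = d \<and>
      (2 \<le> d \<longrightarrow> laplacian_eigenvalue (with_proj H) (d - 1) \<ge> 2 * real d - real n) \<and>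
      digraph_iso (with_proj G) (with_proj (graph_join H (edgeless_graph (n - d))))) \<longleftrightarrow>
    (\<exists>S. split_join G S \<and> card S = d \<and> real d \<le> laplacian_eigenvalue (with_proj G) (n - 1))"
    (is "?L \<longleftrightarrow> ?R")
proof
  assume ?L
  then obtain H :: "nat pair_pre_digraph" where H: "pair_graph H" "card (pverts H) = d"
    "2 \<le> d \<longrightarrow> laplacian_eigenvalue (with_proj H) (d - 1) \<ge> 2 * real d - real n"
    "digraph_iso (with_proj G) (with_proj (graph_join H (edgeless_graph (n - d))))" by blast
  from join_edgeless_iso_imp_split_join[OF G H(1,4)] obtain S \<psi> where S: "split_join G S"
    "bij_betw \<psi> (pverts H) S"
    "\<And>h k. h \<in> pverts H \<Longrightarrow> k \<in> pverts H \<Longrightarrow> (h, k) \<in> parcs H \<longleftrightarrow> (\<psi> h, \<psi> k) \<in> parcs G" by blast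
  have "card S = d" using S(2) H(2) bij_betw_same_card by metis
  then show ?R using split_join_second_smallest_iff[OF G H(1) S n _ d] H(3) S(1) by blast
next
  assume ?R
  then obtain S where S: "split_join G S" "card S = d" "real d \<le> laplacian_eigenvalue (with_proj G) (n - 1)"
    by blast
  interpret pair_graph G by (rule G)
  have "S \<subseteq> pverts G" using S(1) by (simp add: split_join_def)
  then have c: "card (pverts G - S) = n - d"
    using S(2) n pair_finite_verts by (simp add: card_Diff_subset finite_subset)
  from split_join_imp_join_edgeless_iso[OF G S(1), unfolded c]
  obtain H :: "nat pair_pre_digraph" and \<psi> where H: "pair_graph H" "bij_betw \<psi> (pverts H) S"
    "\<And>h k. h \<in> pverts H \<Longrightarrow> k \<in> pverts H \<Longrightarrow> (h, k) \<in> parcs H \<longleftrightarrow> (\<psi> h, \<psi> k) \<in> parcs G"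
    "digraph_iso (with_proj G) (with_proj (graph_join H (edgeless_graph (n - d))))" by blast
  have "card (pverts H) = d" using H(2) S(2) bij_betw_same_card by metis
  then show ?L using split_join_second_smallest_iff[OF G H(1) S(1) H(2,3) n S(2) d] S(3) H(1,4) by blast
qed

text \<open>Vertices of \<open>H\<close> are natural numbers without loss of generality, as
  \<open>G\<close> is described only up to isomorphism. For \<open>\<delta> = 1\<close> the
  eigenvalue with index \<open>\<delta> - 1 = 0\<close> does not exist, and the condition on it is
  read as vacuous.\<close>

theorem theorem1p3:
  fixes G :: "'a pair_pre_digraph" and n \<delta> :: nat
  assumes "pair_graph G"
    and "Digraph_Component.connected (with_proj G)"
    and "card (pverts G) = n"
    and "min_degree (with_proj G) = \<delta>"
  shows
    "(toughness (with_proj G) =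
        ereal (laplacian_eigenvalue (with_proj G) 1 * laplacian_eigenvalue (with_proj G) (n - 1)
               / (real n * (laplacian_eigenvalue (with_proj G) 1 - real \<delta>)))
      \<longleftrightarrow>
      1 \<le> \<delta> \<and> \<delta> + 2 \<le> n \<and>
      (\<exists>H :: nat pair_pre_digraph.
         pair_graph H \<and> card (pverts H) = \<delta> \<and>
         (2 \<le> \<delta> \<longrightarrow>
           laplacian_eigenvalue (with_proj H) (\<delta> - 1) \<ge> 2 * real \<delta> - real n) \<and>
         digraph_iso (with_proj G) (with_proj (graph_join H (edgeless_graph (n - \<delta>))))))
     \<and>
     (toughness (with_proj G) =
        ereal (laplacian_eigenvalue (with_proj G) (n - 1)
               / (laplacian_eigenvalue (with_proj G) 1 - laplacian_eigenvalue (with_proj G) (n - 1)))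
      \<longleftrightarrow>
      1 \<le> \<delta> \<and> \<delta> + 2 \<le> n \<and>
      (\<exists>H :: nat pair_pre_digraph.
         pair_graph H \<and> card (pverts H) = \<delta> \<and>
         (2 \<le> \<delta> \<longrightarrow>
           laplacian_eigenvalue (with_proj H) (\<delta> - 1) \<ge> 2 * real \<delta> - real n) \<and>
         digraph_iso (with_proj G) (with_proj (graph_join H (edgeless_graph (n - \<delta>))))))"
proof -
  interpret connected_graph G n \<delta> using assms by (rule connected_graph.intro)
  show ?thesis
    unfolding toughness_eq_A_iff toughness_eq_B_iff
    using ex_join_edgeless_iso_iff[OF assms(1,3)] by blast
qed

end
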